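(* Let $R>0$, let $v\in C^1([0,R];\mathbb{R})$ satisfy $v'(\rho)<0$ for all $\rho\in[0,R]$, and let $\overline{\rho}\in L^\infty_c(\mathbb{R})\cap BV(\mathbb{R})$ satisfy $0\le\overline{\rho}(x)\le R$ for a.e. $x\in\mathbb{R}$, with $L=\|\overline{\rho}\|_{L^1(\mathbb{R})}>0$. Fix $T>0$, $\theta\in[0,1]$ and two positive integers $M,N$ satisfying the CFL-type condition $$\theta\,N\,T\,[v]_{\mathrm{Lip}}\,R^2< L\,M .$$ Let $\tau=T/M$ and $t^m=m\tau$. Then the discrete density $\rho^M_N$ associated with the fully discrete particle scheme (defined in the context) is well defined on $\mathbb{R}\times[0,T]$ and satisfies: (i) $0\le\rho^M_N(x,t)\le R$ for all $(x,t)\in\mathbb{R}\times[0,T]$; (ii) $\mathrm{TV}[\rho^M_N(\cdot,t^{m+1})]\le \mathrm{TV}[\rho^M_N(\cdot,t^{m})]\le\mathrm{TV}[\overline{\rho}]$ for all $m\in\{0,\dots,M-1\}$; (iii) for all $0\le t_1\le t_2\le T$, $$\|\rho^M_N(\cdot,t_2)-\rho^M_N(\cdot,t_1)\|_{L^1(\mathbb{R})}\le C\,(t_2-t_1+\tau)^{1/2},\qquad C=4\,\bigl(2\,\mathrm{TV}[\overline{\rho}]\,L\,V\bigr)^{1/2},$$ where $V=\max\{|v(0)|,|v(R)|\}$.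
   Context: $L^\infty_c(\mathbb{R})$ is the space of essentially bounded functions with compact support; $[v]_{\mathrm{Lip}}$ is the Lipschitz constant of $v$ on $[0,R]$; $\mathrm{TV}$ is the (essential) total variation in $x$. Particle scheme. Set $\tau=T/M$, $\ell=L/N$, $t^m=m\tau$. Initial positions: $\overline{x}_0=\min(\mathrm{supp}(\overline{\rho}))$ and, for $i\in\{0,\dots,N-1\}$, $\overline{x}_{i+1}=\min\{x\ge\overline{x}_i:\int_{\overline{x}_i}^x\overline{\rho}(y)\,dy\ge\ell\}$. The scheme seeks positions $x_0^m<x_1^m<\dots<x_N^m$, $m\in\{0,\dots,M\}$, with $x_i^0=\overline{x}_i$ for all $i\in\{0,\dots,N\}$ and $$x_i^{m+1}=x_i^m+\tau\bigl(\theta\,v(R_i^m)+(1-\theta)\,v(R_i^{m+1})\bigr),\qquad i\in\{0,\dots,N\},\ m\in\{0,\dots,M-1\},$$ where $R_i^m=\ell/(x_{i+1}^m-x_i^m)$ for $i\in\{0,\dots,N-1\}$ and $R_N^m=0$. (In particular $x_N^{m+1}=x_N^m+\tau v(0)$; given the positions at step $m$, those at step $m+1$ are obtained successively for $i=N,N-1,\dots,0$.) Discrete density: $$\rho^M_N(x,t)=\sum_{m=0}^{M-1}\sum_{i=0}^{N-1}R_i^m\,\mathbf{1}_{[x_i^m,x_{i+1}^m)}(x)\,\mathbf{1}_{[t^m,t^{m+1})}(t)\quad (t\in[0,T)),\qquad \rho^M_N(x,T)=\sum_{i=0}^{N-1}R_i^M\,\mathbf{1}_{[x_i^M,x_{i+1}^M)}(x).$$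 "Well defined" means that the scheme determines uniquely ordered positions $x_0^m<\dots<x_N^m$ for all $m\in\{0,\dots,M\}$, with all $R_i^m$ belonging to the domain $[0,R]$ of $v$. *)

theory Defs
  imports "HOL-Analysis.Analysis"
begin

definition is_min :: "real set \<Rightarrow> real \<Rightarrow> bool" where
  "is_min S x \<longleftrightarrow> x \<in> S \<and> (\<forall>y\<in>S. x \<le> y)"

(* Support of a function defined up to null sets: the complement of the largest open set
   on which the function vanishes almost everywhere. *)
definition ess_support :: "(real \<Rightarrow> real) \<Rightarrow> real set" where
  "ess_support f = {x. \<forall>U. open U \<and> x \<in> U \<longrightarrow> \<not> (AE y in lebesgue. y \<in> U \<longrightarrow> f y = 0)}"

definition Linf_compact :: "(real \<Rightarrow> real) \<Rightarrow> bool" where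
  "Linf_compact f \<longleftrightarrow> f \<in> borel_measurable lebesgue
     \<and> (\<exists>C. AE x in lebesgue. \<bar>f x\<bar> \<le> C) \<and> compact (ess_support f)"

definition L1_norm :: "(real \<Rightarrow> real) \<Rightarrow> ennreal" where
  "L1_norm f = (\<integral>\<^sup>+x. ennreal \<bar>f x\<bar> \<partial>lebesgue)"

definition pointwise_variation :: "(real \<Rightarrow> real) \<Rightarrow> ennreal" where
  "pointwise_variation g =
     (SUP (n, s) \<in> {(n, s). mono (s :: nat \<Rightarrow> real)}. \<Sum>k<n. ennreal \<bar>g (s (Suc k)) - g (s k)\<bar>)"

(* Essential total variation: infimum of the pointwise variation over all representatives
   of the almost-everywhere equivalence class of f. *)
definition TV :: "(real \<Rightarrow> real) \<Rightarrow> ennreal" where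
  "TV f = (INF g \<in> {g. AE x in lebesgue. g x = f x}. pointwise_variation g)"

definition BV :: "(real \<Rightarrow> real) \<Rightarrow> bool" where
  "BV f \<longleftrightarrow> integrable lebesgue f \<and> TV f < \<infinity>"

definition Lip_const :: "real set \<Rightarrow> (real \<Rightarrow> real) \<Rightarrow> real" where
  "Lip_const X f = Inf {C. C-lipschitz_on X f}"

definition initial_positions :: "(real \<Rightarrow> real) \<Rightarrow> real \<Rightarrow> nat \<Rightarrow> (nat \<Rightarrow> real) \<Rightarrow> bool" where
  "initial_positions \<rho>0 l N p \<longleftrightarrow>
     is_min (ess_support \<rho>0) (p 0) \<and>
     (\<forall>i<N. is_min {x. p i \<le> x \<and> l \<le> (LINT y:{p i..x}|lebesgue. \<rho>0 y)} (p (Suc i)))"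

(* Positions are indexed as x m i: time step m first, particle i second. *)
definition cell_density :: "real \<Rightarrow> nat \<Rightarrow> (nat \<Rightarrow> nat \<Rightarrow> real) \<Rightarrow> nat \<Rightarrow> nat \<Rightarrow> real" where
  "cell_density l N x m i = (if i < N then l / (x m (Suc i) - x m i) else 0)"

(* The requirement that the cell densities lie in [0,R] is part of the scheme, because
   the velocity is meaningful only on that interval. *)
definition particle_scheme ::
  "(real \<Rightarrow> real) \<Rightarrow> real \<Rightarrow> real \<Rightarrow> real \<Rightarrow> real \<Rightarrow> nat \<Rightarrow> nat \<Rightarrow> (real \<Rightarrow> real) \<Rightarrow> (nat \<Rightarrow> nat \<Rightarrow> real) \<Rightarrow> bool"
where
  "particle_scheme v R \<theta> \<tau> l M N \<rho>0 x \<longleftrightarrow>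
     initial_positions \<rho>0 l N (x 0) \<and>
     (\<forall>m\<le>M. \<forall>i<N. x m i < x m (Suc i)) \<and>
     (\<forall>m\<le>M. \<forall>i\<le>N. cell_density l N x m i \<in> {0..R}) \<and>
     (\<forall>m<M. \<forall>i\<le>N. x (Suc m) i = x m i
        + \<tau> * (\<theta> * v (cell_density l N x m i) + (1 - \<theta>) * v (cell_density l N x (Suc m) i)))"

definition discrete_density ::
  "real \<Rightarrow> real \<Rightarrow> nat \<Rightarrow> nat \<Rightarrow> (nat \<Rightarrow> nat \<Rightarrow> real) \<Rightarrow> real \<Rightarrow> real \<Rightarrow> real"
where
  "discrete_density l T M N x y t =
     (if t = T then \<Sum>i<N. cell_density l N x M i * indicator {x M i..<x M (Suc i)} y
      else \<Sum>m<M. \<Sum>i<N. cell_density l N x m i * indicator {x m i..<x m (Suc i)} y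
             * indicator {real m * (T / real M)..<real (Suc m) * (T / real M)} t)"

end

theory Submission
  imports Defs
begin

text \<open>
  In terms of the gap \<open>d = x\<^bsub>i+1\<^esub> - x\<^sub>i\<close>, one time step solves \<open>d + \<tau> (1 - \<theta>) v (l / d) = c\<close> from the leader
  downwards; the left-hand side is strictly increasing in \<open>d\<close>, and the CFL condition puts the
  solution above \<open>l / R\<close>. The same condition forces every new density into the convex hull of the two
  old densities of its cell and the next one and of the new density in front, which makes the total
  variation decrease. For the continuity in time, particles move with speed at most \<open>V\<close>, so the
  distribution functions satisfy \<open>F (x - D) \<le> G x \<le> F (x + D)\<close> with \<open>D\<close> proportional to
  the elapsed time. Comparing the difference of the densities with its mean over a window of length
  \<open>h\<close> bounds its norm by \<open>4 D L / h + 2 h TV\<close>, and the best \<open>h\<close> gives the square root.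
\<close>

section \<open>Step functions and their total variation\<close>

text \<open>The implicit share of the velocity needs no restriction: \<open>v\<close> is decreasing,
  so widening a gap never slows the particle behind it. Hence the CFL condition carries the factor
  \<open>\<theta>\<close>. For densities in (0, R] the gap l / r varies with slope at least l / R^2
  in modulus, while the explicit velocity term varies with slope at most
  \<open>\<theta> * \<tau> * K\<close>; the lower bound on new gaps and the hull property both rest
  on this comparison. The densities at two times live on different grids, so they cannot be compared
  cell by cell as functions. What the grids share is the mass \<open>l\<close> of each cell, hence
  the passage to distribution functions. In the constant, 4 D L collects 2 D L from each end of the
  window and 2 h TV the jumps of the two densities; h = sqrt (2 D L / TV) balances them to 4 sqrt (2
  TV L D). Here D = V (t2 - t1 + \<tau>), where \<tau> pays for rounding both times down to the
  grid. Since \<open>TV\<close> is an infimum over representatives, bounds from below go through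
  averages, which do not see null sets.\<close>

definition jump :: "(nat \<Rightarrow> real) \<Rightarrow> nat \<Rightarrow> real" where
  "jump a j = a j - (case j of 0 \<Rightarrow> 0 | Suc i \<Rightarrow> a i)"

text \<open>Counts the jump up from 0 at the left end (\<open>j = 0\<close>); when
  \<open>a N = 0\<close>, the index \<open>j = N\<close> is the drop back to 0 at the right
  end.\<close>

definition jump_variation :: "nat \<Rightarrow> (nat \<Rightarrow> real) \<Rightarrow> real" where
  "jump_variation N a = (\<Sum>j\<le>N. \<bar>jump a j\<bar>)"

definition step_function :: "nat \<Rightarrow> (nat \<Rightarrow> real) \<Rightarrow> (nat \<Rightarrow> real) \<Rightarrow> real \<Rightarrow> real" where
  "step_function N p a y = (\<Sum>i<N. a i * indicator {p i..<p (Suc i)} y)"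

lemma jump_simps [simp]: "jump a 0 = a 0" "jump a (Suc i) = a (Suc i) - a i"
  by (simp_all add: jump_def)

lemma jump_variation_0 [simp]: "jump_variation 0 a = \<bar>a 0\<bar>"
  by (simp add: jump_variation_def)

lemma jump_variation_Suc [simp]:
  "jump_variation (Suc n) a = jump_variation n a + \<bar>a (Suc n) - a n\<bar>"
  by (simp add: jump_variation_def)

lemma jump_variation_nonneg: "0 \<le> jump_variation N a"
  by (simp add: jump_variation_def sum_nonneg)

lemma le_of_steps:
  fixes p :: "nat \<Rightarrow> real"
  assumes "\<And>i. i < N \<Longrightarrow> p i < p (Suc i)" "i \<le> j" "j \<le> N"
  shows "p i \<le> p j"
  using assms(2,3)
proof (induction j rule: dec_induct)
  case (step n)
  then show ?case using assms(1)[of n] by simp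
qed simp

lemma step_function_eq_jumps:
  assumes "\<And>i. i < N \<Longrightarrow> p i < p (Suc i)" "a N = 0"
  shows "step_function N p a y = (\<Sum>j\<le>N. jump a j * indicator {p j..} y)"
proof -
  \<comment> \<open>Summation by parts: the induction carries the boundary term
    \<open>a n * indicator {p n..} y\<close>, which disappears at \<open>N\<close> because
    \<open>a N = 0\<close>.\<close>
  have "n \<le> N \<Longrightarrow> step_function n p a y + a n * indicator {p n..} y
      = (\<Sum>j\<le>n. jump a j * indicator {p j..} y)" for n
  proof (induction n)
    case (Suc n)
    have "p n < p (Suc n)" using assms(1) Suc.prems by simp
    then have "indicator {p n..<p (Suc n)} y = indicator {p n..} y - (indicator {p (Suc n)..} y :: real)"
      by (auto simp: indicator_def)
    then show ?case
      using Suc unfolding step_function_def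
      by (simp add: distrib_left right_diff_distrib left_diff_distrib del: sum_mult_indicator)
  qed (simp add: step_function_def del: sum_mult_indicator)
  from this[of N] show ?thesis using assms(2) by simp
qed

lemma step_function_cases:
  assumes "\<And>i. i < N \<Longrightarrow> p i < p (Suc i)"
  shows "(step_function N p a y = 0 \<and> (\<forall>i<N. y \<notin> {p i..<p (Suc i)}))
    \<or> (\<exists>i<N. y \<in> {p i..<p (Suc i)} \<and> step_function N p a y = a i)"
proof (cases "\<exists>i<N. y \<in> {p i..<p (Suc i)}")
  case True
  then obtain i where i: "i < N" "y \<in> {p i..<p (Suc i)}" by blast
  have "indicator {p j..<p (Suc j)} y = (0::real)" if "j < N" "j \<noteq> i" for j
  proof (cases "j < i")
    case True
    then have "p (Suc j) \<le> p i" using le_of_steps[of N p "Suc j" i] assms i by simp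
    then show ?thesis using i by (auto simp: indicator_def)
  next
    case False
    then have "p (Suc i) \<le> p j" using le_of_steps[of N p "Suc i" j] assms that by simp
    then show ?thesis using i by (auto simp: indicator_def)
  qed
  then have "step_function N p a y = (\<Sum>j<N. if j = i then a i else 0)"
    unfolding step_function_def using i by (intro sum.cong) auto
  then show ?thesis using i by auto
next
  case False
  then have "step_function N p a y = 0"
    by (auto simp: step_function_def indicator_def intro!: sum.neutral)
  then show ?thesis using False by blast
qed

lemma indicator_atLeast_mono:
  fixes x y c :: real
  shows "x \<le> y \<Longrightarrow> (indicator {c..} x :: real) \<le> indicator {c..} y"
  by (auto simp: indicator_def)

text \<open>Written through its jumps, the function is a combination of indicators of half-lines.
  Along an increasing sequence each indicator increases, so its increments telescope to at most
  1.\<close>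

lemma TV_step_function_le:
  assumes "\<And>i. i < N \<Longrightarrow> p i < p (Suc i)" "a N = 0"
  shows "TV (step_function N p a) \<le> ennreal (jump_variation N a)"
proof -
  let ?f = "step_function N p a"
  have "(\<Sum>k<n. ennreal \<bar>?f (s (Suc k)) - ?f (s k)\<bar>) \<le> ennreal (jump_variation N a)"
    if "mono s" for n and s :: "nat \<Rightarrow> real"
  proof -
    let ?h = "\<lambda>j k. indicator {p j..} (s k) :: real"
    have h: "?h j k \<le> ?h j (Suc k)" for j k
      using that by (intro indicator_atLeast_mono) (simp add: mono_iff_le_Suc)
    have "(\<Sum>k<n. \<bar>?f (s (Suc k)) - ?f (s k)\<bar>)
        \<le> (\<Sum>k<n. \<Sum>j\<le>N. \<bar>jump a j\<bar> * (?h j (Suc k) - ?h j k))"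
    proof (rule sum_mono)
      fix k
      have "\<bar>?f (s (Suc k)) - ?f (s k)\<bar> = \<bar>\<Sum>j\<le>N. jump a j * (?h j (Suc k) - ?h j k)\<bar>"
        using assms by (simp add: step_function_eq_jumps sum_subtractf right_diff_distrib)
      also have "\<dots> \<le> (\<Sum>j\<le>N. \<bar>jump a j * (?h j (Suc k) - ?h j k)\<bar>)" by (rule sum_abs)
      also have "\<dots> = (\<Sum>j\<le>N. \<bar>jump a j\<bar> * (?h j (Suc k) - ?h j k))"
        using h by (simp add: abs_mult)
      finally show "\<bar>?f (s (Suc k)) - ?f (s k)\<bar> \<le> \<dots>" .
    qed
    also have "\<dots> = (\<Sum>j\<le>N. \<bar>jump a j\<bar> * (?h j n - ?h j 0))"
      by (subst sum.swap)
        (simp add: sum_distrib_left[symmetric] sum_lessThan_telescope[of "?h _"])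
    also have "\<dots> \<le> (\<Sum>j\<le>N. \<bar>jump a j\<bar> * 1)"
      by (intro sum_mono mult_left_mono) (auto simp: indicator_def)
    finally have "(\<Sum>k<n. \<bar>?f (s (Suc k)) - ?f (s k)\<bar>) \<le> jump_variation N a"
      by (simp add: jump_variation_def)
    then show ?thesis by (simp add: ennreal_leI)
  qed
  then have "pointwise_variation ?f \<le> ennreal (jump_variation N a)"
    unfolding pointwise_variation_def by (intro SUP_least) auto
  moreover have "TV ?f \<le> pointwise_variation ?f"
    unfolding TV_def by (intro INF_lower) simp
  ultimately show ?thesis by (rule order_trans[rotated])
qed

section \<open>Lower bound for the variation of every representative\<close>

lemma AE_lebesgue_imp_negligible:
  fixes P :: "real \<Rightarrow> bool"
  assumes "AE y in lebesgue. P y"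
  shows "negligible {y. \<not> P y}"
proof -
  obtain Z where "{y. \<not> P y} \<subseteq> Z" "emeasure lebesgue Z = 0" "Z \<in> sets lebesgue"
    using assms by (auto elim!: AE_E)
  then have "negligible Z" "{y. \<not> P y} \<subseteq> Z"
    by (auto simp: negligible_iff_null_sets null_sets_def)
  then show ?thesis by (rule negligible_subset)
qed

lemma AE_lebesgue_witness:
  assumes "AE y in lebesgue. P y" "c < (d::real)"
  obtains y where "c < y" "y < d" "P y"
proof -
  obtain Z where Z: "{y. \<not> P y} \<subseteq> Z" "emeasure lebesgue Z = 0" "Z \<in> sets lebesgue"
    using assms(1) by (auto elim!: AE_E)
  have "{c<..<d} \<subseteq> Z \<Longrightarrow> False"
  proof -
    assume "{c<..<d} \<subseteq> Z"
    then have "emeasure lebesgue {c<..<d} \<le> emeasure lebesgue Z" using Z by (intro emeasure_mono)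
    then show False using Z assms(2) by (simp add: ennreal_eq_0_iff)
  qed
  then obtain y where "c < y" "y < d" "y \<notin> Z" by (meson greaterThanLessThan_iff subsetI)
  then show ?thesis using Z(1) that by blast
qed

text \<open>Averaging the variation of a representative along the ordered points
  \<open>p i + s (p (i + 1) - p i)\<close> over \<open>s \<in> [0, 1]\<close> produces the jumps of the averages.\<close>
lemma jump_variation_averages_le_TV:
  assumes p: "\<And>i. i < N \<Longrightarrow> p i < p (Suc i)" and aN: "a N = 0"
    and avg: "\<And>i. i < N \<Longrightarrow> (f has_integral a i * (p (Suc i) - p i)) {p i..p (Suc i)}"
    and outside: "AE y in lebesgue. y < p 0 \<or> p N < y \<longrightarrow> f y = 0"
  shows "ennreal (jump_variation N a) \<le> TV f"
  unfolding TV_def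
proof (rule INF_greatest)
  fix g :: "real \<Rightarrow> real"
  assume "g \<in> {g. AE x in lebesgue. g x = f x}"
  then have gf: "AE x in lebesgue. g x = f x" by simp
  show "ennreal (jump_variation N a) \<le> pointwise_variation g"
  proof (cases "pointwise_variation g")
    case (real B)
    have var: "(\<Sum>k<n. \<bar>g (s (Suc k)) - g (s k)\<bar>) \<le> B" if "mono s" for n s
    proof -
      have "(\<Sum>k<n. ennreal \<bar>g (s (Suc k)) - g (s k)\<bar>) \<le> ennreal B"
        unfolding real(2)[symmetric] pointwise_variation_def
        using that by (intro SUP_upper2[of "(n, s)"]) auto
      then show ?thesis using real(1) by (simp add: ennreal_le_iff)
    qed
    have out: "AE y in lebesgue. y < p 0 \<or> p N < y \<longrightarrow> g y = 0" using outside gf by eventually_elim simp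
    \<comment> \<open>A representative can be arbitrary on a null set, so the two points outside the
      cells are chosen where \<open>g\<close> really vanishes.\<close>
    obtain u where u: "u < p 0" "g u = 0"
      by (rule AE_lebesgue_witness[OF out, of "p 0 - 1" "p 0"]) auto
    obtain w where w: "p N < w" "g w = 0"
      by (rule AE_lebesgue_witness[OF out, of "p N" "p N + 1"]) auto
    have null: "negligible {x. g x \<noteq> f x}"
      using AE_lebesgue_imp_negligible[OF gf] .
    let ?d = "\<lambda>i. p (Suc i) - p i"
    \<comment> \<open>\<open>s\<close> is the relative position inside a cell. The value 0 for
      \<open>i = N\<close> matches \<open>a N = 0\<close> and makes the last difference the drop to
      zero.\<close>
    let ?g = "\<lambda>i s. if i < N then g (p i + s * ?d i) else 0"
    have int: "(?g i has_integral a i) {0..1}" if "i \<le> N" for i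
    proof (cases "i < N")
      case True
      have "(g has_integral a i * ?d i) {p i..p (Suc i)}"
        by (rule has_integral_spike[OF null _ avg[OF True]]) auto
      from has_integral_affinity[OF this[folded cbox_interval], of "?d i" "p i"]
      have "((\<lambda>s. g (?d i * s + p i)) has_integral a i)
          ((\<lambda>x. x / ?d i - p i / ?d i) ` {p i..p (Suc i)})"
        using p[OF True] by (simp add: cbox_interval)
      moreover have "(\<lambda>x. x / ?d i - p i / ?d i) ` {p i..p (Suc i)} = {0..1}"
        using p[OF True]
        by (subst image_affinity_atLeastAtMost_div_diff) (auto simp: diff_divide_distrib[symmetric])
      ultimately show ?thesis using p[OF True] True by (simp add: ac_simps)
    next
      case False
      then show ?thesis using that aN by simp
    qed
    have jint: "((\<lambda>s. case j of 0 \<Rightarrow> ?g 0 s | Suc i \<Rightarrow> ?g (Suc i) s - ?g i s) has_integral jump a j) {0..1}"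
      if "j \<le> N" for j
    proof (cases j)
      case 0
      then show ?thesis using int[of 0] by simp
    next
      case (Suc i)
      then show ?thesis using has_integral_diff[OF int[of "Suc i"] int[of i]] that by simp
    qed
    \<comment> \<open>The signs are those of the jumps of the averages and do not depend on
      \<open>s\<close>. The integral is therefore exactly the jump variation, while the integrand is
      bounded by a variation sum of \<open>g\<close> for each single \<open>s\<close>.\<close>
    have "((\<lambda>s. \<Sum>j\<le>N. sgn (jump a j) * (case j of 0 \<Rightarrow> ?g 0 s | Suc i \<Rightarrow> ?g (Suc i) s - ?g i s))
        has_integral (\<Sum>j\<le>N. sgn (jump a j) * jump a j)) {0..1}"
      by (intro has_integral_sum has_integral_mult_right jint) auto
    moreover have "((\<lambda>s::real. B) has_integral B) {0..1}"
      using has_integral_const_real[of B 0 1] by simp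
    moreover have "(\<Sum>j\<le>N. sgn (jump a j) * (case j of 0 \<Rightarrow> ?g 0 s | Suc i \<Rightarrow> ?g (Suc i) s - ?g i s)) \<le> B"
      if s: "s \<in> {0..1}" for s
    proof -
      \<comment> \<open>The chain starts at \<open>u\<close>, visits one sample point per cell and
        then stays at \<open>w\<close>. Its \<open>Suc N\<close> increments of \<open>g\<close> are
        exactly the differences in the integrand, entry and exit jumps included.\<close>
      define q where "q k = (case k of 0 \<Rightarrow> u | Suc i \<Rightarrow> if i < N then p i + s * ?d i else w)" for k
      have gq: "g (q 0) = 0" "\<And>i. g (q (Suc i)) = ?g i s" using u w by (auto simp: q_def)
      have "q k \<le> q (Suc k)" for k
      proof -
        have bd: "p i \<le> p i + s * ?d i \<and> p i + s * ?d i \<le> p (Suc i)" if "i < N" for i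
        proof -
          have "0 \<le> s * ?d i" using s p[OF that] by simp
          moreover have "s * ?d i \<le> 1 * ?d i" using s p[OF that] by (intro mult_right_mono) auto
          ultimately show ?thesis by simp
        qed
        show ?thesis
        proof (cases k)
          case 0
          have "p 0 \<le> p N" using p by (intro le_of_steps[of N]) auto
          then show ?thesis using 0 u w bd[of 0] by (auto simp: q_def)
        next
          case (Suc i)
          consider "Suc i < N" | "Suc i = N" | "i \<ge> N" by linarith
          then show ?thesis
          proof cases
            case 1
            then show ?thesis using bd[of i] bd[of "Suc i"] Suc by (simp add: q_def)
          next
            case 2
            then show ?thesis using bd[of i] Suc w by (auto simp: q_def)
          next
            case 3
            then show ?thesis using Suc by (simp add: q_def)
          qed
        qed
      qed
      then have "mono q" by (simp add: mono_iff_le_Suc)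
      have "(\<Sum>j\<le>N. sgn (jump a j) * (case j of 0 \<Rightarrow> ?g 0 s | Suc i \<Rightarrow> ?g (Suc i) s - ?g i s))
          \<le> (\<Sum>j\<le>N. \<bar>g (q (Suc j)) - g (q j)\<bar>)"
      proof (rule sum_mono)
        fix j
        have "(case j of 0 \<Rightarrow> ?g 0 s | Suc i \<Rightarrow> ?g (Suc i) s - ?g i s) = g (q (Suc j)) - g (q j)"
          by (cases j) (simp_all add: gq del: if_split)
        moreover have "sgn (jump a j) * t \<le> \<bar>t\<bar>" for t by (auto simp: sgn_if)
        ultimately show "sgn (jump a j) * (case j of 0 \<Rightarrow> ?g 0 s | Suc i \<Rightarrow> ?g (Suc i) s - ?g i s)
          \<le> \<bar>g (q (Suc j)) - g (q j)\<bar>" by simp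
      qed
      also have "\<dots> \<le> B" using var[OF \<open>mono q\<close>, of "Suc N"] by (simp only: lessThan_Suc_atMost)
      finally show ?thesis .
    qed
    ultimately have "(\<Sum>j\<le>N. sgn (jump a j) * jump a j) \<le> B" by (rule has_integral_le)
    then have "jump_variation N a \<le> B"
      by (simp add: jump_variation_def abs_sgn mult.commute)
    then show ?thesis using real by (simp add: ennreal_leI)
  qed simp
qed

lemma step_function_has_integral_cell:
  assumes "\<And>i. i < N \<Longrightarrow> p i < p (Suc i)" "i < N"
  shows "(step_function N p a has_integral a i * (p (Suc i) - p i)) {p i..p (Suc i)}"
proof (rule has_integral_spike_finite)
  show "((\<lambda>_. a i) has_integral a i * (p (Suc i) - p i)) {p i..p (Suc i)}"
    using has_integral_const_real[of "a i" "p i" "p (Suc i)"] assms(1)[OF assms(2)] by (simp add: mult.commute)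
  show "step_function N p a y = a i" if "y \<in> {p i..p (Suc i)} - {p (Suc i)}" for y
  proof -
    have "y \<in> {p i..<p (Suc i)}" using that by auto
    then obtain j where j: "j < N" "y \<in> {p j..<p (Suc j)}" "step_function N p a y = a j"
      using step_function_cases[of N p a y] assms by blast
    have "\<not> j < i" using le_of_steps[of N p "Suc j" i] assms j that by force
    moreover have "\<not> i < j" using le_of_steps[of N p "Suc i" j] assms j that by force
    ultimately show ?thesis using j by simp
  qed
qed auto

lemma TV_step_function:
  assumes p: "\<And>i. i < N \<Longrightarrow> p i < p (Suc i)" and "a N = 0"
  shows "TV (step_function N p a) = ennreal (jump_variation N a)"
proof (rule antisym[OF TV_step_function_le jump_variation_averages_le_TV])
  have "step_function N p a y = 0" if "y < p 0 \<or> p N < y" for y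
  proof -
    have "y \<notin> {p i..<p (Suc i)}" if "i < N" for i
      using le_of_steps[of N p 0 i] le_of_steps[of N p "Suc i" N] p that
        \<open>y < p 0 \<or> p N < y\<close> by auto
    then show ?thesis using step_function_cases[of N p a y] p by blast
  qed
  then show "AE y in lebesgue. y < p 0 \<or> p N < y \<longrightarrow> step_function N p a y = 0" by simp
qed (use assms in \<open>auto intro: step_function_has_integral_cell\<close>)

text \<open>The hull for \<open>b i\<close> contains the new value \<open>b (Suc i)\<close>, so old
  and new jumps cannot be compared one by one. Partial variations are compared up to the error
  \<open>|b n - a n|\<close>, which vanishes at \<open>N\<close>.\<close>

lemma jump_variation_hull_le:
  assumes "\<And>i. i < N \<Longrightarrow> min (a i) (min (a (Suc i)) (b (Suc i))) \<le> b i"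
    and "\<And>i. i < N \<Longrightarrow> b i \<le> max (a i) (max (a (Suc i)) (b (Suc i)))"
    and "b N = a N"
  shows "jump_variation N b \<le> jump_variation N a"
proof -
  have "n \<le> N \<Longrightarrow> jump_variation n b \<le> jump_variation n a + \<bar>b n - a n\<bar>" for n
  proof (induction n)
    case (Suc n)
    \<comment> \<open>The route from \<open>a n\<close> through \<open>a (Suc n)\<close> to
      \<open>b (Suc n)\<close> sweeps the whole hull and so passes \<open>b n\<close>; it is at
      least as long as the route through \<open>b n\<close> alone.\<close>
    then have "\<bar>b n - a n\<bar> + \<bar>b (Suc n) - b n\<bar> \<le> \<bar>a (Suc n) - a n\<bar> + \<bar>b (Suc n) - a (Suc n)\<bar>"
      using assms(1,2)[of n] by (auto simp: min_def max_def abs_if split: if_splits)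
    then show ?case using Suc by simp
  qed simp
  from this[of N] show ?thesis using assms(3) by simp
qed

section \<open>The norm of the difference of two step densities\<close>

definition ramp :: "real \<Rightarrow> real \<Rightarrow> real \<Rightarrow> real" where
  "ramp p q y = max 0 (min 1 ((y - p) / (q - p)))"

lemma ramp_shift: "ramp (p + D) (q + D) y = ramp p q (y - D)"
  by (simp add: ramp_def algebra_simps)

lemma ramp_eq:
  assumes "p < q"
  shows "ramp p q y = (if y \<le> p then 0 else if y \<le> q then (y - p) / (q - p) else 1)"
  using assms by (auto simp: ramp_def min_def max_def divide_simps)

lemma ramp_antimono:
  assumes "p < q" "p' < q'" "p \<le> p'" "q \<le> q'"
  shows "ramp p' q' y \<le> ramp p q y"
proof (cases "p' < y \<and> y < q")
  case True
  \<comment> \<open>The intermediate cell from \<open>p'\<close> to \<open>q\<close> lets the two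
    end points be moved separately.\<close>
  have "(y - p') / (q' - p') \<le> (y - p') / (q - p')"
    using True assms by (intro divide_left_mono) auto
  also have "\<dots> \<le> (y - p) / (q - p)"
  proof -
    have "0 \<le> (q - y) * (p' - p)" using True assms by (intro mult_nonneg_nonneg) auto
    then have "(y - p') * (q - p) \<le> (y - p) * (q - p')" by (simp add: algebra_simps)
    then show ?thesis using True assms by (simp add: frac_le_eq divide_le_eq pos_le_divide_eq)
  qed
  finally show ?thesis by (auto simp: ramp_def)
next
  case False
  then show ?thesis using assms by (auto simp: ramp_eq divide_simps)
qed

lemma ramp_mono: "p < q \<Longrightarrow> x \<le> y \<Longrightarrow> ramp p q x \<le> ramp p q y"
  using ramp_antimono[of p q "p + (y - x)" "q + (y - x)" y] ramp_shift[of p "y - x" q y] by simp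

lemma ramp_scaled: "p < q \<Longrightarrow> (q - p) * ramp p q y = max 0 (min (q - p) (y - p))"
  by (simp add: ramp_eq)

lemma ramp_measurable [measurable]: "ramp p q \<in> borel_measurable borel"
  unfolding ramp_def[abs_def] by measurable

lemma nn_integral_indicator_ramp:
  assumes "p < q" "x \<le> y"
  shows "(\<integral>\<^sup>+t. indicator {p..<q} t * indicator {x..y} t \<partial>lborel)
    = ennreal ((q - p) * (ramp p q y - ramp p q x))"
proof -
  have "(\<integral>\<^sup>+t. indicator {p..<q} t * indicator {x..y} t \<partial>lborel) = emeasure lborel ({p..<q} \<inter> {x..y})"
    by (simp flip: indicator_inter_arith)
  also have "\<dots> = ennreal (max 0 (min (q - p) (y - p)) - max 0 (min (q - p) (x - p)))"
  proof (cases "y < q")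
    case True
    then have "{p..<q} \<inter> {x..y} = {max p x..y}" by auto
    moreover have "max 0 (min (q - p) (y - p)) - max 0 (min (q - p) (x - p))
        = (if max p x \<le> y then y - max p x else 0)"
      using assms True by (auto simp: min_def max_def)
    ultimately show ?thesis by (cases "max p x \<le> y") (simp_all only: if_True if_False, simp_all)
  next
    case False
    then have "{p..<q} \<inter> {x..y} = {max p x..<q}" using assms by auto
    moreover have "max 0 (min (q - p) (y - p)) - max 0 (min (q - p) (x - p))
        = (if max p x \<le> q then q - max p x else 0)"
      using assms False by (auto simp: min_def max_def)
    ultimately show ?thesis
      by (cases "max p x \<le> q") (simp_all only: if_True if_False, simp_all del: max.bounded_iff)
  qed
  finally show ?thesis using assms(1) by (simp add: right_diff_distrib ramp_scaled)
qed

text \<open>The increment is the uniform mass of the window from \<open>x - D\<close> to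
  \<open>x + D\<close>. By Tonelli, each point \<open>t\<close> of the cell lies in the windows of a
  set of centres \<open>x\<close> of length 2 D. The identity is multiplied by the width of the cell
  to keep divisions out of \<open>ennreal\<close>.\<close>

lemma nn_integral_ramp_window:
  assumes "p < q" "0 \<le> D"
  shows "(\<integral>\<^sup>+x. ennreal (ramp p q (x + D) - ramp p q (x - D)) \<partial>lborel) = ennreal (2 * D)"
proof -
  have "ennreal (q - p) * (\<integral>\<^sup>+x. ennreal (ramp p q (x + D) - ramp p q (x - D)) \<partial>lborel)
      = (\<integral>\<^sup>+x. ennreal (q - p) * ennreal (ramp p q (x + D) - ramp p q (x - D)) \<partial>lborel)"
    by (rule nn_integral_cmult[symmetric]) measurable
  also have "\<dots> = (\<integral>\<^sup>+x. (\<integral>\<^sup>+t. indicator {p..<q} t * indicator {x - D..x + D} t \<partial>lborel) \<partial>lborel)"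
    using assms by (intro nn_integral_cong) (simp add: nn_integral_indicator_ramp ennreal_mult')
  also have "\<dots> = (\<integral>\<^sup>+t. (\<integral>\<^sup>+x. indicator {p..<q} t * indicator {x - D..x + D} t \<partial>lborel) \<partial>lborel)"
  proof (rule lborel_pair.Fubini')
    have "(\<lambda>z. indicator {p..<q} (fst z) * indicator {z. snd z - D \<le> fst z \<and> fst z \<le> snd z + D} z :: ennreal)
        \<in> borel_measurable (lborel \<Otimes>\<^sub>M lborel)"
      by measurable
    also have "(\<lambda>z. indicator {p..<q} (fst z) * indicator {z. snd z - D \<le> fst z \<and> fst z \<le> snd z + D} z :: ennreal)
        = (\<lambda>(t, x). indicator {p..<q} t * indicator {x - D..x + D} t)"
      by (simp add: indicator_def fun_eq_iff)
    finally show "(\<lambda>(t, x). indicator {p..<q} t * indicator {x - D..x + D} t :: ennreal)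
        \<in> borel_measurable (lborel \<Otimes>\<^sub>M lborel)" .
  qed
  also have "\<dots> = (\<integral>\<^sup>+t. indicator {p..<q} t * ennreal (2 * D) \<partial>lborel)"
  proof (rule nn_integral_cong)
    fix t
    have "indicator {x - D..x + D} t = (indicator {t - D..t + D} x :: ennreal)" for x
      by (auto simp: indicator_def)
    then show "(\<integral>\<^sup>+x. indicator {p..<q} t * indicator {x - D..x + D} t \<partial>lborel)
        = indicator {p..<q} t * ennreal (2 * D)"
      using assms by (simp add: nn_integral_cmult)
  qed
  also have "\<dots> = ennreal (q - p) * ennreal (2 * D)"
    using assms by (simp add: nn_integral_multc)
  finally show ?thesis
    using assms by (simp only: ennreal_mult_cancel_left) auto
qed

section \<open>Distribution functions of step densities and their displacement\<close>

definition gap_density :: "real \<Rightarrow> nat \<Rightarrow> (nat \<Rightarrow> real) \<Rightarrow> nat \<Rightarrow> real" where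
  "gap_density l N p i = (if i < N then l / (p (Suc i) - p i) else 0)"

text \<open>The distribution function of the step density, each of whose cells carries the mass \<open>l\<close>.\<close>
definition cumulative :: "real \<Rightarrow> nat \<Rightarrow> (nat \<Rightarrow> real) \<Rightarrow> real \<Rightarrow> real" where
  "cumulative l N p y = l * (\<Sum>i<N. ramp (p i) (p (Suc i)) y)"

lemma cumulative_mono:
  assumes "\<And>i. i < N \<Longrightarrow> p i < p (Suc i)" "0 \<le> l" "x \<le> y"
  shows "cumulative l N p x \<le> cumulative l N p y"
  using assms by (auto simp: cumulative_def intro!: mult_left_mono sum_mono ramp_mono)

lemma cumulative_measurable [measurable]: "cumulative l N p \<in> borel_measurable borel"
  unfolding cumulative_def[abs_def] by measurable

lemma step_function_measurable [measurable]: "step_function N p a \<in> borel_measurable borel"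
  unfolding step_function_def[abs_def] by measurable

text \<open>Cells with the same index carry the same mass \<open>l\<close> whatever their widths, so
  it suffices to compare ramps cell by cell, each against its translate by \<open>D\<close>.\<close>

lemma cumulative_sandwich:
  assumes "\<And>i. i < N \<Longrightarrow> p i < p (Suc i)" "\<And>i. i < N \<Longrightarrow> q i < q (Suc i)" "0 \<le> l"
    and D: "\<And>i. i \<le> N \<Longrightarrow> \<bar>q i - p i\<bar> \<le> D"
  shows "cumulative l N p (y - D) \<le> cumulative l N q y" "cumulative l N q y \<le> cumulative l N p (y + D)"
proof -
  show "cumulative l N p (y - D) \<le> cumulative l N q y"
    unfolding cumulative_def
  proof (intro mult_left_mono sum_mono)
    fix i assume "i \<in> {..<N}"
    then show "ramp (p i) (p (Suc i)) (y - D) \<le> ramp (q i) (q (Suc i)) y"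
      unfolding ramp_shift[symmetric] using assms(1,2)[of i] D[of i] D[of "Suc i"]
      by (intro ramp_antimono) auto
  qed fact
  show "cumulative l N q y \<le> cumulative l N p (y + D)"
    unfolding cumulative_def
  proof (intro mult_left_mono sum_mono)
    fix i assume "i \<in> {..<N}"
    then show "ramp (q i) (q (Suc i)) y \<le> ramp (p i) (p (Suc i)) (y + D)"
      using ramp_shift[of "p i" "-D" "p (Suc i)" y] assms(1,2)[of i] D[of i] D[of "Suc i"]
        ramp_antimono[of "p i - D" "p (Suc i) - D" "q i" "q (Suc i)" y] by (auto simp: abs_le_iff)
  qed fact
qed

lemma nn_integral_cumulative_window:
  assumes "\<And>i. i < N \<Longrightarrow> p i < p (Suc i)" "0 \<le> l" "0 \<le> D"
  shows "(\<integral>\<^sup>+x. ennreal (cumulative l N p (x + D) - cumulative l N p (x - D)) \<partial>lborel)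
    = ennreal (2 * D * (real N * l))"
proof -
  have "ennreal (cumulative l N p (x + D) - cumulative l N p (x - D))
      = ennreal l * (\<Sum>i<N. ennreal (ramp (p i) (p (Suc i)) (x + D) - ramp (p i) (p (Suc i)) (x - D)))" for x
  proof -
    have "cumulative l N p (x + D) - cumulative l N p (x - D)
        = l * (\<Sum>i<N. ramp (p i) (p (Suc i)) (x + D) - ramp (p i) (p (Suc i)) (x - D))"
      by (simp add: cumulative_def right_diff_distrib sum_subtractf)
    then show ?thesis
      using assms by (subst sum_ennreal) (simp_all add: ramp_mono ennreal_mult')
  qed
  then have "(\<integral>\<^sup>+x. ennreal (cumulative l N p (x + D) - cumulative l N p (x - D)) \<partial>lborel)
      = ennreal l * (\<Sum>i<N. \<integral>\<^sup>+x. ennreal (ramp (p i) (p (Suc i)) (x + D) - ramp (p i) (p (Suc i)) (x - D)) \<partial>lborel)"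
    by (simp add: nn_integral_cmult nn_integral_sum)
  also have "\<dots> = ennreal l * (\<Sum>i<N. ennreal (2 * D))"
    using assms by (simp add: nn_integral_ramp_window)
  also have "\<dots> = ennreal (2 * D * (real N * l))"
    using assms by (simp add: ennreal_of_nat_eq_real_of_nat ennreal_mult[symmetric] ac_simps)
  finally show ?thesis .
qed

lemma indicator_has_integral_ramp:
  assumes "p < q" "x \<le> y"
  shows "((indicator {p..<q} :: real \<Rightarrow> real) has_integral (q - p) * (ramp p q y - ramp p q x)) {x..y}"
proof -
  have "(\<integral>\<^sup>+t. ennreal (indicator {p..<q} t * indicator {x..y} t) \<partial>lborel)
      = ennreal ((q - p) * (ramp p q y - ramp p q x))"
    using nn_integral_indicator_ramp[OF assms]
    by (simp add: ennreal_mult ennreal_indicator)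
  then have "((\<lambda>t. indicator {p..<q} t * indicator {x..y} t :: real) has_integral
      (q - p) * (ramp p q y - ramp p q x)) UNIV"
    using assms by (intro nn_integral_has_integral) (auto simp: ramp_mono)
  then have "((\<lambda>t. if t \<in> {x..y} then indicator {p..<q} t else 0 :: real) has_integral
      (q - p) * (ramp p q y - ramp p q x)) UNIV"
    by (rule has_integral_eq[rotated]) (auto simp: indicator_def)
  then show ?thesis by (simp only: has_integral_restrict_UNIV)
qed

lemma step_function_has_integral_cumulative:
  assumes "\<And>i. i < N \<Longrightarrow> p i < p (Suc i)" "x \<le> y"
  shows "(step_function N p (gap_density l N p) has_integral
    cumulative l N p y - cumulative l N p x) {x..y}"
proof -
  have "(step_function N p (gap_density l N p) has_integral
      (\<Sum>i<N. gap_density l N p i * ((p (Suc i) - p i) *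
        (ramp (p i) (p (Suc i)) y - ramp (p i) (p (Suc i)) x)))) {x..y}"
    unfolding step_function_def
    using assms by (intro has_integral_sum has_integral_mult_right indicator_has_integral_ramp) auto
  moreover have "gap_density l N p i * ((p (Suc i) - p i) * t) = l * t" if "i < N" for i t
    using assms(1)[OF that] that by (simp add: gap_density_def)
  ultimately show ?thesis
    by (simp add: cumulative_def sum_subtractf sum_distrib_left right_diff_distrib)
qed

text \<open>A jump at \<open>p j\<close> is felt between \<open>x\<close> and \<open>y\<close> only
  if \<open>p j\<close> lies in that interval, which forces \<open>x\<close> into a window of length
  \<open>h\<close> to the left of \<open>p j\<close>.\<close>

lemma step_function_shift_diff_le:
  assumes "\<And>i. i < N \<Longrightarrow> p i < p (Suc i)" "a N = 0" "x \<le> y" "y \<le> x + h"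
  shows "\<bar>step_function N p a y - step_function N p a x\<bar>
    \<le> (\<Sum>j\<le>N. \<bar>jump a j\<bar> * indicator {p j - h..p j} x)"
proof -
  have "step_function N p a y - step_function N p a x
      = (\<Sum>j\<le>N. jump a j * (indicator {p j..} y - indicator {p j..} x))"
    using assms by (simp add: step_function_eq_jumps sum_subtractf right_diff_distrib)
  also have "\<bar>\<dots>\<bar> \<le> (\<Sum>j\<le>N. \<bar>jump a j * (indicator {p j..} y - indicator {p j..} x)\<bar>)"
    by (rule sum_abs)
  also have "\<dots> \<le> (\<Sum>j\<le>N. \<bar>jump a j\<bar> * indicator {p j - h..p j} x)"
    unfolding abs_mult using assms(3,4) by (intro sum_mono mult_left_mono) (auto simp: indicator_def)
  finally show ?thesis .
qed

lemma nn_integral_jump_windows: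
  assumes "0 \<le> h"
  shows "(\<integral>\<^sup>+x. ennreal (\<Sum>j\<le>N. \<bar>jump a j\<bar> * indicator {p j - h..p j} x) \<partial>lborel)
    = ennreal (h * jump_variation N a)"
proof -
  have "ennreal (\<Sum>j\<le>N. \<bar>jump a j\<bar> * indicator {p j - h..p j} x)
      = (\<Sum>j\<le>N. ennreal \<bar>jump a j\<bar> * indicator {p j - h..p j} x)" for x
  proof -
    have "(\<Sum>j\<le>N. ennreal (\<bar>jump a j\<bar> * indicator {p j - h..p j} x))
        = ennreal (\<Sum>j\<le>N. \<bar>jump a j\<bar> * indicator {p j - h..p j} x)"
      by (rule sum_ennreal) simp
    then show ?thesis by (simp only: ennreal_mult'' indicator_pos_le ennreal_indicator)
  qed
  then have "(\<integral>\<^sup>+x. ennreal (\<Sum>j\<le>N. \<bar>jump a j\<bar> * indicator {p j - h..p j} x) \<partial>lborel)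
      = (\<Sum>j\<le>N. \<integral>\<^sup>+x. ennreal \<bar>jump a j\<bar> * indicator {p j - h..p j} x \<partial>lborel)"
    by (simp add: nn_integral_sum del: sum_mult_indicator)
  also have "\<dots> = (\<Sum>j\<le>N. ennreal (h * \<bar>jump a j\<bar>))"
    using assms by (simp add: nn_integral_cmult ennreal_mult mult.commute)
  also have "\<dots> = ennreal (h * jump_variation N a)"
    using assms by (simp add: sum_ennreal jump_variation_def sum_distrib_left)
  finally show ?thesis .
qed

text \<open>An interpolation between the Wasserstein distance and the total variation: the difference
  \<open>u\<close> of the densities is compared with its average over \<open>[x, x + h]\<close>, which is a difference
  quotient of the distribution functions.\<close>
lemma L1_step_function_diff_aux:
  fixes h D B l :: real
  assumes p: "\<And>i. i < N \<Longrightarrow> p i < p (Suc i)" and q: "\<And>i. i < N \<Longrightarrow> q i < q (Suc i)"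
    and l: "0 \<le> l" and h: "0 < h"
    and D: "\<And>i. i \<le> N \<Longrightarrow> \<bar>q i - p i\<bar> \<le> D" "0 \<le> D"
    and B: "jump_variation N (gap_density l N p) \<le> B" "jump_variation N (gap_density l N q) \<le> B"
  shows "(\<integral>\<^sup>+x. ennreal \<bar>step_function N q (gap_density l N q) x - step_function N p (gap_density l N p) x\<bar> \<partial>lborel)
    \<le> ennreal (4 * D * (real N * l) / h + 2 * h * B)"
proof -
  let ?a = "gap_density l N p" and ?b = "gap_density l N q"
  let ?f = "step_function N p ?a" and ?g = "step_function N q ?b"
  let ?F = "cumulative l N p" and ?G = "cumulative l N q"
  let ?W = "\<lambda>x. ?F (x + D) - ?F (x - D)"
  let ?J = "\<lambda>r a x. \<Sum>j\<le>N. \<bar>jump a j\<bar> * indicator {r j - h..r j} x :: real"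
  have N0: "?a N = 0" "?b N = 0" by (simp_all add: gap_density_def)
  have W: "0 \<le> ?W x" for x
    using cumulative_mono[of N p l "x - D" "x + D"] p l D(2) by simp
  have J: "0 \<le> ?J r a x" for r a x by (auto intro!: sum_nonneg)
  have GF: "\<bar>?G x - ?F x\<bar> \<le> ?W x" for x
    using cumulative_sandwich[of N p q l D x] p q l D cumulative_mono[of N p l "x - D" x]
      cumulative_mono[of N p l x "x + D"] by (simp add: abs_le_iff)
  have pt: "h * \<bar>?g x - ?f x\<bar> \<le> ?W x + ?W (x + h) + h * (?J p ?a x + ?J q ?b x)" for x
  proof -
    let ?u = "\<lambda>y. ?g y - ?f y"
    let ?K = "?J p ?a x + ?J q ?b x"
    have osc: "\<bar>?u y - ?u x\<bar> \<le> ?K" if "y \<in> {x..x + h}" for y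
    proof -
      have "\<bar>?f y - ?f x\<bar> \<le> ?J p ?a x" "\<bar>?g y - ?g x\<bar> \<le> ?J q ?b x"
        using that by (auto intro!: step_function_shift_diff_le p q N0 simp del: sum_mult_indicator)
      then show ?thesis by linarith
    qed
    have int: "(?u has_integral (?G (x + h) - ?G x) - (?F (x + h) - ?F x)) {x..x + h}"
      using h p q by (intro has_integral_diff step_function_has_integral_cumulative) auto
    have c: "((\<lambda>_. c) has_integral h * c) {x..x + h}" for c :: real
      using has_integral_const_real[of c x "x + h"] h by simp
    \<comment> \<open>Over the window \<open>?u\<close> stays between the constants
      \<open>?u x - ?K\<close> and \<open>?u x + ?K\<close>; integrating both bounds compares
      \<open>h * ?u x\<close> with the increment of \<open>?G - ?F\<close>.\<close>
    have "h * (?u x - ?K) \<le> (?G (x + h) - ?G x) - (?F (x + h) - ?F x)"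
    proof (rule has_integral_le[OF c int])
      show "?u x - ?K \<le> ?u y" if "y \<in> {x..x + h}" for y using osc[OF that] by linarith
    qed
    moreover have "(?G (x + h) - ?G x) - (?F (x + h) - ?F x) \<le> h * (?u x + ?K)"
    proof (rule has_integral_le[OF int c])
      show "?u y \<le> ?u x + ?K" if "y \<in> {x..x + h}" for y using osc[OF that] by linarith
    qed
    ultimately have "\<bar>h * ?u x\<bar> \<le> \<bar>(?G (x + h) - ?F (x + h)) - (?G x - ?F x)\<bar> + h * ?K"
      unfolding right_diff_distrib[of h "?u x"] distrib_left[of h "?u x"] by linarith
    also have "\<dots> \<le> ?W x + ?W (x + h) + h * ?K" using GF[of x] GF[of "x + h"] by linarith
    finally show ?thesis using h by (simp add: abs_mult)
  qed
  have meas: "?J r a \<in> borel_measurable lborel" for r a by measurable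
  \<comment> \<open>By translation invariance both ends of the window cost the same, which turns 2 D
    into the factor 4 D.\<close>
  have shift: "(\<integral>\<^sup>+x. ennreal (?W (x + h)) \<partial>lborel) = (\<integral>\<^sup>+x. ennreal (?W x) \<partial>lborel)"
    using nn_integral_real_affine[of "\<lambda>x. ennreal (?W x)" 1 h] by (simp add: add.commute)
  have "ennreal h * (\<integral>\<^sup>+x. ennreal \<bar>?g x - ?f x\<bar> \<partial>lborel) = (\<integral>\<^sup>+x. ennreal (h * \<bar>?g x - ?f x\<bar>) \<partial>lborel)"
    using h by (simp add: ennreal_mult nn_integral_cmult)
  also have "\<dots> \<le> (\<integral>\<^sup>+x. (ennreal (?W x) + ennreal (?W (x + h))) + ennreal h * (ennreal (?J p ?a x) + ennreal (?J q ?b x)) \<partial>lborel)"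
  proof (rule nn_integral_mono)
    fix x
    have "ennreal (h * \<bar>?g x - ?f x\<bar>) \<le> ennreal (?W x + ?W (x + h) + h * (?J p ?a x + ?J q ?b x))"
      by (intro ennreal_leI pt)
    then show "ennreal (h * \<bar>?g x - ?f x\<bar>) \<le> (ennreal (?W x) + ennreal (?W (x + h)))
        + ennreal h * (ennreal (?J p ?a x) + ennreal (?J q ?b x))"
      using W J h by (simp add: ennreal_plus[symmetric] ennreal_mult[symmetric] del: ennreal_plus)
  qed
  also have "\<dots> = (ennreal (2 * D * (real N * l)) + ennreal (2 * D * (real N * l)))
      + ennreal h * (ennreal (h * jump_variation N ?a) + ennreal (h * jump_variation N ?b))"
    using p l h D(2) meas
    by (simp add: nn_integral_add nn_integral_cmult shift nn_integral_cumulative_window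
        nn_integral_jump_windows del: sum_mult_indicator)
  also have "\<dots> = ennreal (4 * D * (real N * l) + h * (h * jump_variation N ?a + h * jump_variation N ?b))"
    using l h D(2) jump_variation_nonneg[of N ?a] jump_variation_nonneg[of N ?b]
    by (simp add: ennreal_plus[symmetric] ennreal_mult[symmetric] del: ennreal_plus)
  also have "\<dots> \<le> ennreal (h * (4 * D * (real N * l) / h + 2 * h * B))"
  proof (rule ennreal_leI)
    have "h * (h * jump_variation N ?a + h * jump_variation N ?b) \<le> h * (h * B + h * B)"
      using h B by (intro mult_left_mono add_mono) auto
    then show "4 * D * (real N * l) + h * (h * jump_variation N ?a + h * jump_variation N ?b)
        \<le> h * (4 * D * (real N * l) / h + 2 * h * B)"
      using h by (simp add: distrib_left algebra_simps)
  qed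
  also have "\<dots> = ennreal h * ennreal (4 * D * (real N * l) / h + 2 * h * B)"
    using h by (intro ennreal_mult') simp
  finally have "ennreal h * (\<integral>\<^sup>+x. ennreal \<bar>?g x - ?f x\<bar> \<partial>lborel) \<le> ennreal h * ennreal (4 * D * (real N * l) / h + 2 * h * B)" .
  then show ?thesis
    using h by (subst (asm) ennreal_mult_le_mult_iff) auto
qed

lemma L1_step_function_diff_le:
  fixes D B l :: real
  assumes p: "\<And>i. i < N \<Longrightarrow> p i < p (Suc i)" and q: "\<And>i. i < N \<Longrightarrow> q i < q (Suc i)"
    and l: "0 < l" and N: "0 < N"
    and D: "\<And>i. i \<le> N \<Longrightarrow> \<bar>q i - p i\<bar> \<le> D" "0 < D"
    and B: "jump_variation N (gap_density l N p) \<le> B" "jump_variation N (gap_density l N q) \<le> B" "0 < B"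
  shows "L1_norm (\<lambda>x. step_function N q (gap_density l N q) x - step_function N p (gap_density l N p) x)
    \<le> ennreal (4 * sqrt (2 * B * (real N * l) * D))"
proof -
  let ?m = "real N * l"
  \<comment> \<open>With the window \<open>h = r / B\<close> the two terms 4 D L / h and 2 h B are
    equal, each being \<open>2 * r\<close>; this choice minimises their sum.\<close>
  define r where "r = sqrt (2 * B * ?m * D)"
  have "0 < 2 * B * ?m * D" using l N D B by (intro mult_pos_pos) auto
  then have r: "0 < r" "r * r = 2 * B * ?m * D"
    by (simp_all only: r_def real_sqrt_gt_zero real_sqrt_mult_self abs_of_pos)
  have "4 * D * ?m / (r / B) = 2 * (2 * B * ?m * D) / r"
    by (simp only: divide_divide_eq_right mult.assoc mult.commute mult.left_commute)
  also have "\<dots> = 2 * r" unfolding r(2)[symmetric] using r(1) by simp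
  finally have *: "4 * D * ?m / (r / B) + 2 * (r / B) * B = 4 * r" using B(3) by simp
  have rB: "0 < r / B" using r(1) B(3) by simp
  have "L1_norm (\<lambda>x. step_function N q (gap_density l N q) x - step_function N p (gap_density l N p) x)
      = (\<integral>\<^sup>+x. ennreal \<bar>step_function N q (gap_density l N q) x - step_function N p (gap_density l N p) x\<bar> \<partial>lborel)"
    unfolding L1_norm_def by (rule nn_integral_completion) measurable
  also have "\<dots> \<le> ennreal (4 * D * ?m / (r / B) + 2 * (r / B) * B)"
    by (rule L1_step_function_diff_aux[OF p q less_imp_le[OF l] rB D(1) less_imp_le[OF D(2)] B(1,2)])
  finally show ?thesis unfolding * by (simp only: r_def)
qed

section \<open>One time step\<close>

text \<open>Isolates what the scheme takes from a C^1 velocity with negative derivative;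
  \<open>K\<close> may be any Lipschitz constant.\<close>

locale decreasing_velocity =
  fixes v :: "real \<Rightarrow> real" and R K :: real
  assumes R_pos: "0 < R"
    and v_strict: "\<And>a b. 0 \<le> a \<Longrightarrow> a < b \<Longrightarrow> b \<le> R \<Longrightarrow> v b < v a"
    and v_lipschitz: "K-lipschitz_on {0..R} v"
begin

lemma K_nonneg: "0 \<le> K"
  using v_lipschitz by (rule lipschitz_on_nonneg)

lemma v_antimono: "0 \<le> a \<Longrightarrow> a \<le> b \<Longrightarrow> b \<le> R \<Longrightarrow> v b \<le> v a"
  using v_strict[of a b] by (cases "a = b") auto

lemma v_diff_le: "0 \<le> a \<Longrightarrow> a \<le> b \<Longrightarrow> b \<le> R \<Longrightarrow> v a - v b \<le> K * (b - a)"
  using lipschitz_onD[OF v_lipschitz, of a b] v_antimono[of a b] by (simp add: dist_real_def)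

lemma v_bound:
  assumes "0 \<le> a" "a \<le> R"
  shows "\<bar>v a\<bar> \<le> max \<bar>v 0\<bar> \<bar>v R\<bar>"
  using v_antimono[of 0 a] v_antimono[of a R] assms by (auto simp: abs_if)

lemma v_bound_pos: "0 < max \<bar>v 0\<bar> \<bar>v R\<bar>"
  using v_strict[of 0 R] R_pos by auto

end

definition admissible :: "real \<Rightarrow> real \<Rightarrow> nat \<Rightarrow> (nat \<Rightarrow> real) \<Rightarrow> bool" where
  "admissible R l N p \<longleftrightarrow> (\<forall>i<N. p i < p (Suc i) \<and> l / (p (Suc i) - p i) \<le> R)"

lemma admissible_less: "admissible R l N p \<Longrightarrow> i < N \<Longrightarrow> p i < p (Suc i)"
  by (simp add: admissible_def)

lemma gap_density_N [simp]: "gap_density l N p N = 0"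
  by (simp add: gap_density_def)

lemma gap_density_pos: "admissible R l N p \<Longrightarrow> 0 < l \<Longrightarrow> i < N \<Longrightarrow> 0 < gap_density l N p i"
  by (simp add: admissible_def gap_density_def)

lemma gap_density_nonneg: "admissible R l N p \<Longrightarrow> 0 < l \<Longrightarrow> 0 \<le> gap_density l N p i"
  using gap_density_pos[of R l N p i] by (cases "i < N") (auto simp: gap_density_def)

lemma gap_density_le: "admissible R l N p \<Longrightarrow> 0 < R \<Longrightarrow> gap_density l N p i \<le> R"
  by (simp add: admissible_def gap_density_def)

definition time_step ::
  "(real \<Rightarrow> real) \<Rightarrow> real \<Rightarrow> real \<Rightarrow> real \<Rightarrow> nat \<Rightarrow> (nat \<Rightarrow> real) \<Rightarrow> (nat \<Rightarrow> real) \<Rightarrow> nat \<Rightarrow> bool"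
where
  "time_step v \<theta> \<tau> l N p q i \<longleftrightarrow>
    q i = p i + \<tau> * (\<theta> * v (gap_density l N p i) + (1 - \<theta>) * v (gap_density l N q i))"

locale particle_step = decreasing_velocity +
  fixes \<theta> \<tau> l :: real and N :: nat
  assumes theta: "0 \<le> \<theta>" "\<theta> \<le> 1" and tau: "0 < \<tau>" and l: "0 < l"
    and CFL: "\<theta> * \<tau> * K * R\<^sup>2 < l"
begin

text \<open>The slope \<open>l / (a * b)\<close> of the chord of l / r is at least l / R^2, and the
  CFL condition says that this exceeds \<open>\<theta> * \<tau> * K\<close>.\<close>

lemma inverse_gap_ge:
  assumes "0 < a" "a \<le> b" "b \<le> R"
  shows "\<theta> * \<tau> * K * (b - a) \<le> l / a - l / b"
    and "a < b \<Longrightarrow> \<theta> * \<tau> * K * (b - a) < l / a - l / b"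
proof -
  have eq: "l / a - l / b = l / (a * b) * (b - a)" using assms by (simp add: field_simps)
  have "a * b \<le> R * R" using assms by (intro mult_mono) auto
  then have "\<theta> * \<tau> * K * (a * b) \<le> \<theta> * \<tau> * K * R\<^sup>2"
    unfolding power2_eq_square using theta tau K_nonneg by (intro mult_left_mono) auto
  then have "\<theta> * \<tau> * K * (a * b) < l" using CFL by simp
  then have "\<theta> * \<tau> * K < l / (a * b)" using assms by (simp add: pos_less_divide_eq)
  then show "\<theta> * \<tau> * K * (b - a) \<le> l / a - l / b"
    and "a < b \<Longrightarrow> \<theta> * \<tau> * K * (b - a) < l / a - l / b"
    unfolding eq using assms by (simp_all only: mult_right_mono mult_strict_right_mono diff_ge_0_iff_ge
        diff_gt_0_iff_gt less_imp_le)
qed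

section \<open>Solving one step for the gaps\<close>

lemma implicit_gap_exists:
  assumes "l / R + \<tau> * (1 - \<theta>) * v R \<le> c"
  obtains d where "l / R \<le> d" "d + \<tau> * (1 - \<theta>) * v (l / d) = c"
proof -
  let ?H = "\<lambda>d. d + \<tau> * (1 - \<theta>) * v (l / d)"
  \<comment> \<open>Upper end for the intermediate value theorem: \<open>v (l / b)\<close> is at
    least \<open>v R\<close>, so the left-hand side has reached \<open>c\<close> at
    \<open>b\<close>. The maximum keeps \<open>l / b\<close> inside the domain of
    \<open>v\<close>.\<close>
  define b where "b = max (l / R) (c - \<tau> * (1 - \<theta>) * v R)"
  have lR: "0 < l / R" using l R_pos by simp
  have range: "l / d \<in> {0..R}" if "l / R \<le> d" for d
  proof -
    have "0 < d" using that lR by simp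
    then show ?thesis using that l R_pos by (simp add: field_simps)
  qed
  have "?H (l / R) \<le> c" using assms l R_pos by simp
  moreover have "c \<le> ?H b"
  proof -
    have "v R \<le> v (l / b)" using range[of b] R_pos by (intro v_antimono) (auto simp: b_def)
    then have "\<tau> * (1 - \<theta>) * v R \<le> \<tau> * (1 - \<theta>) * v (l / b)"
      using tau theta by (intro mult_left_mono) auto
    then show ?thesis by (simp add: b_def)
  qed
  moreover have "continuous_on {l / R..b} ?H"
  proof -
    have "continuous_on {l / R..b} (\<lambda>d. v (l / d))"
      using lR range
      by (intro continuous_on_compose2[OF lipschitz_on_continuous_on[OF v_lipschitz]] continuous_intros)
        auto
    then show ?thesis by (intro continuous_intros)
  qed
  ultimately obtain d where "l / R \<le> d" "?H d = c"
    using IVT'[of ?H "l / R" c b] by (auto simp: b_def)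
  then show ?thesis using that by blast
qed

lemma implicit_gap_strict:
  assumes "0 < d" "d < d'" "l / d \<le> R"
  shows "d + \<tau> * (1 - \<theta>) * v (l / d) < d' + \<tau> * (1 - \<theta>) * v (l / d')"
proof -
  have "l / d' \<le> l / d" using assms l by (intro divide_left_mono) auto
  then have "v (l / d) \<le> v (l / d')" using assms l by (intro v_antimono) auto
  then have "\<tau> * (1 - \<theta>) * v (l / d) \<le> \<tau> * (1 - \<theta>) * v (l / d')"
    using tau theta by (intro mult_left_mono) auto
  then show ?thesis using assms by simp
qed

lemma time_step_exists:
  assumes p: "admissible R l N p"
  shows "\<exists>q. admissible R l N q \<and> (\<forall>i\<le>N. time_step v \<theta> \<tau> l N p q i)"
proof -
  let ?P = "\<lambda>k q. (\<forall>i. k \<le> i \<and> i < N \<longrightarrow> q i < q (Suc i) \<and> l / (q (Suc i) - q i) \<le> R)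
      \<and> (\<forall>i. k \<le> i \<and> i \<le> N \<longrightarrow> time_step v \<theta> \<tau> l N p q i)"
  have "k \<le> N \<Longrightarrow> \<exists>q. ?P k q" for k
  proof (induction k rule: inc_induct)
    case base
    show ?case
      \<comment> \<open>Only the value at \<open>N\<close> matters here. The leader has density 0 at
        both times, so its explicit and implicit shares add up to \<open>v 0\<close>.\<close>
      by (rule exI[of _ "\<lambda>_. p N + \<tau> * v 0"])
        (auto simp: time_step_def ring_distribs)
  next
    case (step k)
    then obtain q where q: "?P (Suc k) q" by blast
    \<comment> \<open>Everything known in the equation for the new gap behind particle
      \<open>Suc k\<close>, whose new position is already fixed.\<close>
    define c where "c = q (Suc k) - p k - \<tau> * (\<theta> * v (gap_density l N p k))"
    let ?r = "gap_density l N p k" and ?s = "gap_density l N p (Suc k)" and ?t = "gap_density l N q (Suc k)"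
    have k: "k < N" using step by simp
    have r: "0 < ?r" "?r \<le> R" "?r = l / (p (Suc k) - p k)"
      using gap_density_pos[OF p l k] gap_density_le[OF p R_pos] k by simp_all (simp add: gap_density_def)
    have s: "0 \<le> ?s" "?s \<le> R"
      using gap_density_nonneg[OF p l] gap_density_le[OF p R_pos] by auto
    have t: "0 \<le> ?t" "?t \<le> R"
      using q l R_pos by (auto simp: gap_density_def)
    \<comment> \<open>The particle in front advances by at least \<open>\<tau> * v R\<close>. The
      explicit excess \<open>\<tau> * \<theta> * (v ?r - v R)\<close> of the particle behind is
      covered by the surplus \<open>l / ?r - l / R\<close> of the old gap.\<close>
    have "l / R + \<tau> * (1 - \<theta>) * v R \<le> c"
    proof -
      have "q (Suc k) = p (Suc k) + \<tau> * (\<theta> * v ?s + (1 - \<theta>) * v ?t)"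
        using q k by (simp add: time_step_def)
      moreover have "\<tau> * (\<theta> * v R + (1 - \<theta>) * v R) \<le> \<tau> * (\<theta> * v ?s + (1 - \<theta>) * v ?t)"
        using tau theta v_antimono[of ?s R] v_antimono[of ?t R] s t
        by (intro mult_left_mono add_mono) auto
      moreover have "p (Suc k) - p k = l / ?r" using r k p l by (simp add: admissible_def)
      moreover have "\<tau> * (\<theta> * v ?r) - \<tau> * (\<theta> * v R) \<le> l / ?r - l / R"
      proof -
        have "\<tau> * \<theta> * (v ?r - v R) \<le> \<tau> * \<theta> * (K * (R - ?r))"
          using tau theta r v_diff_le[of ?r R] by (intro mult_left_mono) auto
        also have "\<dots> \<le> l / ?r - l / R" using inverse_gap_ge(1)[of ?r R] r by (simp add: ac_simps)
        finally show ?thesis by (simp add: algebra_simps)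
      qed
      ultimately show ?thesis unfolding c_def by (simp add: algebra_simps)
    qed
    then obtain d where d: "l / R \<le> d" "d + \<tau> * (1 - \<theta>) * v (l / d) = c"
      by (rule implicit_gap_exists)
    have d0: "0 < d" using d(1) l R_pos by (meson divide_pos_pos less_le_trans)
    define q' where "q' = q(k := q (Suc k) - d)"
    have same: "q' i = q i" if "Suc k \<le> i" for i using that by (simp add: q'_def)
    have gap: "q' (Suc k) - q' k = d" by (simp add: q'_def)
    have "?P k q'"
    proof (intro conjI allI impI)
      fix i assume i: "k \<le> i \<and> i < N"
      show "q' i < q' (Suc i)" "l / (q' (Suc i) - q' i) \<le> R"
        using q i gap d0 d(1) R_pos by (cases "i = k"; auto simp: same field_simps)+
    next
      fix i assume i: "k \<le> i \<and> i \<le> N"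
      show "time_step v \<theta> \<tau> l N p q' i"
      proof (cases "i = k")
        case True
        have "gap_density l N q' k = l / d" using k gap by (simp add: gap_density_def)
        then show ?thesis
          using d(2) True by (simp add: time_step_def c_def q'_def algebra_simps)
      next
        case False
        then have "gap_density l N q' i = gap_density l N q i" using i by (simp add: gap_density_def same)
        then show ?thesis using q i False by (simp add: time_step_def same)
      qed
    qed
    then show ?case by blast
  qed
  from this[of 0] obtain q where "?P 0 q" by auto
  then show ?thesis by (intro exI[of _ q]) (simp add: admissible_def)
qed

lemma time_step_unique:
  assumes p: "\<And>i. i \<le> N \<Longrightarrow> p i = p' i"
    and q: "admissible R l N q" "\<And>i. i \<le> N \<Longrightarrow> time_step v \<theta> \<tau> l N p q i"
    and q': "admissible R l N q'" "\<And>i. i \<le> N \<Longrightarrow> time_step v \<theta> \<tau> l N p' q' i"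
    and i: "i \<le> N"
  shows "q i = q' i"
  using i
proof (induction i rule: inc_induct)
  case base
  then show ?case using p[of N] q(2)[of N] q'(2)[of N] by (simp add: time_step_def)
next
  case (step k)
  let ?d = "q (Suc k) - q k" and ?d' = "q' (Suc k) - q' k"
  have k: "k < N" using step by simp
  have gd: "gap_density l N p k = gap_density l N p' k" using p k by (simp add: gap_density_def)
  have "?d + \<tau> * (1 - \<theta>) * v (l / ?d) = ?d' + \<tau> * (1 - \<theta>) * v (l / ?d')"
  proof -
    have "l / ?d = gap_density l N q k" "l / ?d' = gap_density l N q' k"
      using k by (simp_all add: gap_density_def)
    then show ?thesis
      using q(2)[of k] q'(2)[of k] k p[of k] step.IH unfolding time_step_def gd
      by (simp only:) (simp add: algebra_simps)
  qed
  moreover have "0 < ?d" "l / ?d \<le> R" "0 < ?d'" "l / ?d' \<le> R"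
    using q(1) q'(1) k by (auto simp: admissible_def)
  ultimately have "?d = ?d'"
    using implicit_gap_strict[of ?d ?d'] implicit_gap_strict[of ?d' ?d]
    by (cases ?d ?d' rule: linorder_cases) auto
  then show ?case using step.IH by simp
qed

section \<open>Bounds propagated by one step\<close>

lemma time_step_displacement:
  assumes "admissible R l N p" "admissible R l N q" "time_step v \<theta> \<tau> l N p q i"
  shows "\<bar>q i - p i\<bar> \<le> \<tau> * max \<bar>v 0\<bar> \<bar>v R\<bar>"
proof -
  let ?V = "max \<bar>v 0\<bar> \<bar>v R\<bar>" and ?r = "gap_density l N p i" and ?s = "gap_density l N q i"
  have "\<bar>\<theta> * v ?r + (1 - \<theta>) * v ?s\<bar> \<le> \<theta> * \<bar>v ?r\<bar> + (1 - \<theta>) * \<bar>v ?s\<bar>"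
    using theta abs_triangle_ineq[of "\<theta> * v ?r" "(1 - \<theta>) * v ?s"] by (simp add: abs_mult)
  also have "\<dots> \<le> \<theta> * ?V + (1 - \<theta>) * ?V"
    using theta v_bound[of ?r] v_bound[of ?s] gap_density_nonneg gap_density_le assms(1,2) l R_pos
    by (intro add_mono mult_left_mono) auto
  finally have "\<bar>\<theta> * v ?r + (1 - \<theta>) * v ?s\<bar> \<le> ?V" by (simp add: algebra_simps)
  then show ?thesis using assms(3) tau by (simp add: time_step_def abs_mult)
qed

text \<open>A discrete maximum principle: a new density outside the hull of its neighbours would make the
  new gap change faster than the CFL condition allows.\<close>
lemma time_step_hull:
  assumes p: "admissible R l N p" and q: "admissible R l N q"
    and ts: "\<And>i. i \<le> N \<Longrightarrow> time_step v \<theta> \<tau> l N p q i" and i: "i < N"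
  defines "a \<equiv> gap_density l N p" and "b \<equiv> gap_density l N q"
  shows "min (a i) (min (a (Suc i)) (b (Suc i))) \<le> b i"
    and "b i \<le> max (a i) (max (a (Suc i)) (b (Suc i)))"
proof -
  have a: "0 \<le> a j" "a j \<le> R" and b: "0 \<le> b j" "b j \<le> R" for j
    using gap_density_nonneg gap_density_le p q l R_pos by (auto simp: a_def b_def)
  have pos: "0 < a i" "0 < b i" using gap_density_pos p q l i by (auto simp: a_def b_def)
  have "q (Suc i) - q i = p (Suc i) - p i
      + \<tau> * (\<theta> * (v (a (Suc i)) - v (a i)) + (1 - \<theta>) * (v (b (Suc i)) - v (b i)))"
    using ts[of i] ts[of "Suc i"] i by (simp add: time_step_def a_def b_def algebra_simps)
  moreover have "q (Suc i) - q i = l / b i" "p (Suc i) - p i = l / a i"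
    using i l p q by (auto simp: a_def b_def gap_density_def admissible_def)
  \<comment> \<open>The change of the gap, with the velocity differences split into an explicit and
    an implicit part; assuming a violated hull fixes the sign of the implicit part.\<close>
  ultimately have eq: "l / b i - l / a i
      = \<tau> * \<theta> * (v (a (Suc i)) - v (a i)) + \<tau> * (1 - \<theta>) * (v (b (Suc i)) - v (b i))"
    by (simp add: algebra_simps)
  have coeff: "0 \<le> \<tau> * \<theta>" "0 \<le> \<tau> * (1 - \<theta>)" using tau theta by simp_all
  show "b i \<le> max (a i) (max (a (Suc i)) (b (Suc i)))"
  proof (rule ccontr)
    assume "\<not> ?thesis"
    then have gt: "a i < b i" "a (Suc i) < b i" "b (Suc i) < b i" by auto
    have "0 \<le> \<tau> * (1 - \<theta>) * (v (b (Suc i)) - v (b i))"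
      using coeff v_antimono[of "b (Suc i)" "b i"] b gt by simp
    \<comment> \<open>The order of \<open>a i\<close> and \<open>a (Suc i)\<close> is unknown.
      Replacing \<open>a (Suc i)\<close> by the larger \<open>b i\<close> costs only monotonicity
      and leaves a Lipschitz bound in \<open>b i - a i\<close>, which the strict CFL inequality
      contradicts.\<close>
    moreover have "\<tau> * \<theta> * (v (a i) - v (a (Suc i))) \<le> \<tau> * \<theta> * (K * (b i - a i))"
    proof (rule mult_left_mono[OF _ coeff(1)])
      have "v (b i) \<le> v (a (Suc i))" using v_antimono[of "a (Suc i)" "b i"] a b gt by simp
      then show "v (a i) - v (a (Suc i)) \<le> K * (b i - a i)"
        using v_diff_le[of "a i" "b i"] a b gt by simp
    qed
    ultimately show False
      using eq inverse_gap_ge(2)[of "a i" "b i"] pos gt b[of i] by (simp add: algebra_simps)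
  qed
  show "min (a i) (min (a (Suc i)) (b (Suc i))) \<le> b i"
  proof (rule ccontr)
    assume "\<not> ?thesis"
    then have gt: "b i < a i" "b i < a (Suc i)" "b i < b (Suc i)" by auto
    have "\<tau> * (1 - \<theta>) * (v (b (Suc i)) - v (b i)) \<le> 0"
      using coeff v_antimono[of "b i" "b (Suc i)"] b gt by (simp add: mult_nonneg_nonpos)
    moreover have "\<tau> * \<theta> * (v (a (Suc i)) - v (a i)) \<le> \<tau> * \<theta> * (K * (a i - b i))"
    proof (rule mult_left_mono[OF _ coeff(1)])
      have "v (a (Suc i)) \<le> v (b i)" using v_antimono[of "b i" "a (Suc i)"] a b gt by simp
      then show "v (a (Suc i)) - v (a i) \<le> K * (a i - b i)"
        using v_diff_le[of "b i" "a i"] a b gt by simp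
    qed
    ultimately show False
      using eq inverse_gap_ge(2)[of "b i" "a i"] pos gt a[of i] by (simp add: algebra_simps)
  qed
qed

lemma time_step_jump_variation:
  assumes "admissible R l N p" "admissible R l N q" "\<And>i. i \<le> N \<Longrightarrow> time_step v \<theta> \<tau> l N p q i"
  shows "jump_variation N (gap_density l N q) \<le> jump_variation N (gap_density l N p)"
  by (rule jump_variation_hull_le) (use time_step_hull assms in auto)

end

section \<open>Initial positions\<close>

lemma is_min_unique: "is_min S x \<Longrightarrow> is_min S y \<Longrightarrow> x = y"
  by (meson antisym is_min_def)

lemma is_min_Inf:
  assumes "closed S" "S \<noteq> {}" "bdd_below S"
  shows "is_min S (Inf S)"
  using assms by (simp add: is_min_def closed_contains_Inf cInf_lower)

text \<open>The complement of the support is a possibly uncountable union of open sets on which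
  \<open>f\<close> vanishes almost everywhere; Lindelof reduces it to a countable one.\<close>

lemma AE_zero_outside_ess_support: "AE y in lebesgue. y \<notin> ess_support f \<longrightarrow> f y = 0"
proof -
  define \<U> where "\<U> = {U. open U \<and> (AE y in lebesgue. y \<in> U \<longrightarrow> f y = 0)}"
  obtain \<V> where \<V>: "\<V> \<subseteq> \<U>" "countable \<V>" "\<Union>\<V> = \<Union>\<U>"
    using Lindelof[of \<U>] by (auto simp: \<U>_def)
  have "AE y in lebesgue. \<forall>U\<in>\<V>. y \<in> U \<longrightarrow> f y = 0"
    using \<V> by (subst AE_ball_countable) (auto simp: \<U>_def)
  then show ?thesis
  proof eventually_elim
    case (elim y)
    have "y \<in> \<Union>\<U>" if "y \<notin> ess_support f"
      using that by (auto simp: ess_support_def \<U>_def)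
    then show ?case using elim \<V>(3) by blast
  qed
qed

locale initial_density =
  fixes \<rho>0 :: "real \<Rightarrow> real" and R L :: real
  assumes integrable: "integrable lebesgue \<rho>0"
    and range: "AE y in lebesgue. 0 \<le> \<rho>0 y \<and> \<rho>0 y \<le> R"
    and mass: "L1_norm \<rho>0 = ennreal L" and L_pos: "0 < L"
    and compact: "compact (ess_support \<rho>0)"
begin

lemma integral_UNIV: "integral\<^sup>L lebesgue \<rho>0 = L"
proof -
  have "ennreal (integral\<^sup>L lebesgue \<rho>0) = (\<integral>\<^sup>+x. ennreal (\<rho>0 x) \<partial>lebesgue)"
    using range by (intro nn_integral_eq_integral[symmetric] integrable) auto
  also have "\<dots> = L1_norm \<rho>0"
    unfolding L1_norm_def using range by (intro nn_integral_cong_AE) auto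
  finally show ?thesis
    using mass L_pos integral_nonneg_AE[of \<rho>0 lebesgue] range by auto
qed

lemma set_integrable: "S \<in> sets lebesgue \<Longrightarrow> set_integrable lebesgue S \<rho>0"
  unfolding set_integrable_def using integrable by (intro integrable_mult_indicator)

lemma integrable_on: "\<rho>0 integrable_on {a..b}"
  by (rule set_lebesgue_integral_eq_integral(1)[OF set_integrable]) simp

lemma LINT_eq_integral: "(LINT y:{a..b}|lebesgue. \<rho>0 y) = integral {a..b} \<rho>0"
  by (rule set_lebesgue_integral_eq_integral(2)[OF set_integrable]) simp

lemma integral_nonneg': "0 \<le> integral {a..b} \<rho>0"
proof -
  have "0 \<le> (LINT y:{a..b}|lebesgue. \<rho>0 y)"
    unfolding set_lebesgue_integral_def using range
    by (intro integral_nonneg_AE) (auto simp: indicator_def)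
  then show ?thesis by (simp add: LINT_eq_integral)
qed

lemma integral_le: "a \<le> b \<Longrightarrow> integral {a..b} \<rho>0 \<le> R * (b - a)"
proof -
  assume ab: "a \<le> b"
  let ?Z = "{y. \<not> (0 \<le> \<rho>0 y \<and> \<rho>0 y \<le> R)}"
  \<comment> \<open>Changing the function on a null set makes the bound by \<open>R\<close> hold
    everywhere.\<close>
  have "((\<lambda>y. if y \<in> ?Z then R else \<rho>0 y) has_integral integral {a..b} \<rho>0) {a..b}"
    by (rule has_integral_spike[OF AE_lebesgue_imp_negligible[OF range] _ integrable_integral[OF integrable_on]]) auto
  moreover have "((\<lambda>_. R) has_integral R * (b - a)) {a..b}"
    using has_integral_const_real[of R a b] ab by (simp add: mult.commute)
  ultimately show ?thesis by (rule has_integral_le) auto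
qed

lemma integral_append: "a \<le> b \<Longrightarrow> b \<le> c \<Longrightarrow> integral {a..b} \<rho>0 + integral {b..c} \<rho>0 = integral {a..c} \<rho>0"
  by (rule Henstock_Kurzweil_Integration.integral_combine) (auto intro: integrable_on)

lemma support_nonempty: "ess_support \<rho>0 \<noteq> {}"
proof
  assume "ess_support \<rho>0 = {}"
  then have "AE y in lebesgue. \<rho>0 y = 0" using AE_zero_outside_ess_support[of \<rho>0] by simp
  then have "integral\<^sup>L lebesgue \<rho>0 = 0" by (rule integral_eq_zero_AE)
  then show False using integral_UNIV L_pos by simp
qed

lemma integral_eq_mass:
  assumes "ess_support \<rho>0 \<subseteq> {a..b}"
  shows "integral {a..b} \<rho>0 = L"
proof -
  have "AE y in lebesgue. indicator {a..b} y *\<^sub>R \<rho>0 y = \<rho>0 y"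
    using AE_zero_outside_ess_support[of \<rho>0] by eventually_elim (use assms in \<open>auto simp: indicator_def\<close>)
  then have "(LINT y:{a..b}|lebesgue. \<rho>0 y) = integral\<^sup>L lebesgue \<rho>0"
    unfolding set_lebesgue_integral_def
    using integrable set_integrable[of "{a..b}"]
    by (intro integral_cong_AE) (auto simp: set_integrable_def dest: borel_measurable_integrable)
  then show ?thesis by (simp add: LINT_eq_integral integral_UNIV)
qed

lemma support_bounds:
  obtains a b where "is_min (ess_support \<rho>0) a" "ess_support \<rho>0 \<subseteq> {a..b}" "a \<le> b"
proof -
  have bdd: "bounded (ess_support \<rho>0)" and cl: "closed (ess_support \<rho>0)"
    using compact by (auto simp: compact_imp_bounded compact_imp_closed)
  let ?a = "Inf (ess_support \<rho>0)" and ?b = "Sup (ess_support \<rho>0)"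
  have 1: "is_min (ess_support \<rho>0) ?a"
    using bounded_imp_bdd_below[OF bdd] by (intro is_min_Inf cl support_nonempty)
  moreover have "ess_support \<rho>0 \<subseteq> {?a..?b}"
    using bounded_imp_bdd_above[OF bdd] 1 by (auto simp: is_min_def intro: cSup_upper)
  moreover from this have "?a \<le> ?b" using 1 by (auto simp: is_min_def)
  ultimately show ?thesis using that by blast
qed

text \<open>The mass from \<open>c\<close> to \<open>x\<close> is continuous in \<open>x\<close>.
  Hence the candidate set is closed and has a minimum, where the mass equals \<open>l\<close>
  exactly: any excess would mean that \<open>l\<close> was reached earlier.\<close>

lemma next_position:
  assumes mass: "l \<le> integral {c..b} \<rho>0" "0 < l"
  defines "S \<equiv> {x. c \<le> x \<and> l \<le> (LINT y:{c..x}|lebesgue. \<rho>0 y)}"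
  shows "is_min S (Inf S)" and "is_min S d \<Longrightarrow> c < d \<and> integral {c..d} \<rho>0 = l"
proof -
  let ?F = "\<lambda>x. integral {c..x} \<rho>0"
  have S: "S = {x. c \<le> x \<and> l \<le> ?F x}" by (simp add: S_def LINT_eq_integral)
  have cont: "continuous_on {c..x} ?F" for x
    by (rule indefinite_integral_continuous_1[OF integrable_on])
  have cb: "c < b"
  proof (rule ccontr)
    assume "\<not> c < b"
    then have "integral {c..b} \<rho>0 = 0" by (cases "c = b") auto
    then show False using mass by simp
  qed
  have mono: "?F x \<le> ?F y" if "c \<le> x" "x \<le> y" for x y
    using integral_append[OF that] integral_nonneg'[of x y] by simp
  have bS: "b \<in> S" using mass cb by (simp add: S)
  have "closed S"
  proof -
    have "closed (S \<inter> {c..b})"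
    proof -
      have "S \<inter> {c..b} = {c..b} \<inter> ?F -` {l..}" by (auto simp: S)
      then show ?thesis using continuous_closed_preimage[OF cont[of b], of "{l..}"] by simp
    qed
    \<comment> \<open>Continuity is used only up to \<open>b\<close>; beyond \<open>b\<close> the
      mass no longer decreases, so every point qualifies.\<close>
    moreover have "S = (S \<inter> {c..b}) \<union> {b..}"
    proof -
      have "x \<in> S" if "b \<le> x" for x using mono[of b x] cb that bS by (auto simp: S)
      then show ?thesis by (auto simp: S)
    qed
    ultimately show ?thesis by (metis closed_Un closed_atLeast)
  qed
  then show "is_min S (Inf S)"
    using bS by (intro is_min_Inf) (auto simp: S bdd_below_def)
  assume d: "is_min S d"
  then have d1: "c \<le> d" "l \<le> ?F d" and dmin: "\<And>x. c \<le> x \<Longrightarrow> l \<le> ?F x \<Longrightarrow> d \<le> x"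
    by (auto simp: is_min_def S)
  have "c \<noteq> d" using d1 mass by auto
  moreover obtain x where "c \<le> x" "x \<le> d" "?F x = l"
    using IVT'[of ?F c l d] d1 mass cont by auto
  moreover from this have "x = d" using dmin[of x] by simp
  ultimately show "c < d \<and> ?F d = l" using d1 by simp
qed

context
  fixes l :: real and N :: nat
  assumes l: "l = L / real N" and N: "0 < N"
begin

lemma l_pos: "0 < l"
  using l N L_pos by simp

text \<open>After fewer than \<open>N\<close> cells of mass L / N at least one such portion is left.
  The bound \<open>max b c\<close> spares a proof that \<open>c\<close> lies to the left of
  \<open>b\<close>.\<close>

lemma remaining_mass:
  assumes a: "is_min (ess_support \<rho>0) a" "ess_support \<rho>0 \<subseteq> {a..b}" "a \<le> b"
    and c: "a \<le> c" "integral {a..c} \<rho>0 = real i * l" and i: "i < N"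
  shows "l \<le> integral {c..max b c} \<rho>0"
proof -
  have "integral {a..max b c} \<rho>0 = L" using a(2) by (intro integral_eq_mass) fastforce
  then have "integral {c..max b c} \<rho>0 = L - real i * l"
    using integral_append[of a c "max b c"] c by simp
  moreover have "real (Suc i) * l \<le> real N * l" using i l_pos by (intro mult_right_mono) auto
  moreover have "real N * l = L" using l N by simp
  ultimately show ?thesis by (simp add: algebra_simps)
qed

lemma initial_positions_props:
  assumes p: "initial_positions \<rho>0 l N p" and i: "i \<le> N"
  shows "p 0 \<le> p i \<and> integral {p 0..p i} \<rho>0 = real i * l
    \<and> (\<forall>j<i. p j < p (Suc j) \<and> integral {p j..p (Suc j)} \<rho>0 = l)"
  using i
proof (induction i)
  case 0
  then show ?case by simp
next
  case (Suc i)
  obtain a b where ab: "is_min (ess_support \<rho>0) a" "ess_support \<rho>0 \<subseteq> {a..b}" "a \<le> b"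
    by (rule support_bounds)
  have a: "p 0 = a" using p ab by (auto simp: initial_positions_def intro: is_min_unique)
  have IH: "p 0 \<le> p i" "integral {p 0..p i} \<rho>0 = real i * l" 
    "\<forall>j<i. p j < p (Suc j) \<and> integral {p j..p (Suc j)} \<rho>0 = l" using Suc by simp_all
  have "l \<le> integral {p i..max b (p i)} \<rho>0"
    using ab IH Suc.prems by (intro remaining_mass[of a b "p i" i]) (auto simp: a)
  moreover have "is_min {x. p i \<le> x \<and> l \<le> (LINT y:{p i..x}|lebesgue. \<rho>0 y)} (p (Suc i))"
    using p Suc.prems by (simp add: initial_positions_def)
  ultimately have "p i < p (Suc i)" "integral {p i..p (Suc i)} \<rho>0 = l"
    using next_position(2) l_pos by blast+
  then show ?case
    using IH integral_append[of "p 0" "p i" "p (Suc i)"] by (auto simp: less_Suc_eq algebra_simps)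
qed

lemma initial_positions_exist: "\<exists>p. initial_positions \<rho>0 l N p"
proof -
  obtain a b where ab: "is_min (ess_support \<rho>0) a" "ess_support \<rho>0 \<subseteq> {a..b}" "a \<le> b"
    by (rule support_bounds)
  let ?S = "\<lambda>c. {x. c \<le> x \<and> l \<le> (LINT y:{c..x}|lebesgue. \<rho>0 y)}"
  \<comment> \<open>\<open>Inf\<close> is a total candidate for the next position; it is an attained
    minimum as long as mass \<open>l\<close> remains, that is for \<open>i < N\<close>.\<close>
  define p where "p = rec_nat a (\<lambda>_ c. Inf (?S c))"
  have p: "p 0 = a" "\<And>i. p (Suc i) = Inf (?S (p i))" by (simp_all add: p_def)
  have "i \<le> N \<Longrightarrow> a \<le> p i \<and> integral {a..p i} \<rho>0 = real i * l \<and> (\<forall>j<i. is_min (?S (p j)) (p (Suc j)))" for i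
  proof (induction i)
    case 0
    then show ?case by (simp add: p)
  next
    case (Suc i)
    then have IH: "a \<le> p i" "integral {a..p i} \<rho>0 = real i * l" "\<forall>j<i. is_min (?S (p j)) (p (Suc j))"
      by simp_all
    have rem: "l \<le> integral {p i..max b (p i)} \<rho>0"
      using Suc.prems by (intro remaining_mass[OF ab IH(1,2)]) simp
    have min: "is_min (?S (p i)) (p (Suc i))"
      unfolding p(2) by (rule next_position(1)[OF rem l_pos])
    then have "p i < p (Suc i)" "integral {p i..p (Suc i)} \<rho>0 = l"
      using next_position(2)[OF rem l_pos] by blast+
    then show ?case
      using IH min integral_append[of a "p i" "p (Suc i)"] by (auto simp: less_Suc_eq algebra_simps)
  qed
  from this[of N] show ?thesis using ab(1) p(1) by (auto simp: initial_positions_def)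
qed

lemma initial_positions_unique:
  assumes "initial_positions \<rho>0 l N p" "initial_positions \<rho>0 l N q" "i \<le> N"
  shows "p i = q i"
  using assms(3)
proof (induction i)
  case 0
  then show ?case using assms(1,2) by (auto simp: initial_positions_def intro: is_min_unique)
next
  case (Suc i)
  then have i: "i < N" and eq: "p i = q i" by simp_all
  have "is_min {x. p i \<le> x \<and> l \<le> (LINT y:{p i..x}|lebesgue. \<rho>0 y)} (p (Suc i))"
    using assms(1) i by (simp add: initial_positions_def)
  moreover have "is_min {x. q i \<le> x \<and> l \<le> (LINT y:{q i..x}|lebesgue. \<rho>0 y)} (q (Suc i))"
    using assms(2) i by (simp add: initial_positions_def)
  ultimately show ?case unfolding eq by (rule is_min_unique)
qed

lemma initial_positions_admissible:
  assumes p: "initial_positions \<rho>0 l N p"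
  shows "admissible R l N p"
  unfolding admissible_def
proof (intro allI impI)
  fix i assume i: "i < N"
  then have "p i < p (Suc i)" "integral {p i..p (Suc i)} \<rho>0 = l"
    using initial_positions_props[OF p, of N] by simp_all
  then show "p i < p (Suc i) \<and> l / (p (Suc i) - p i) \<le> R"
    using integral_le[of "p i" "p (Suc i)"] by (simp add: pos_divide_le_eq)
qed

text \<open>The \<open>N\<close> cells already carry the whole mass \<open>L\<close>, so the
  nonnegative density has integral zero outside them.\<close>

lemma AE_zero_outside_positions:
  assumes p: "initial_positions \<rho>0 l N p"
  shows "AE y in lebesgue. y < p 0 \<or> p N < y \<longrightarrow> \<rho>0 y = 0"
proof -
  have min: "is_min (ess_support \<rho>0) (p 0)" using p by (simp add: initial_positions_def)
  have "(LINT y:{p 0..p N}|lebesgue. \<rho>0 y) = L"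
    using initial_positions_props[OF p, of N] l N by (simp add: LINT_eq_integral)
  moreover have "(LINT y:UNIV|lebesgue. \<rho>0 y) = L"
    using integral_UNIV by (simp add: set_lebesgue_integral_def)
  moreover have "(LINT y:{p 0..p N} \<union> - {p 0..p N}|lebesgue. \<rho>0 y)
      = (LINT y:{p 0..p N}|lebesgue. \<rho>0 y) + (LINT y:- {p 0..p N}|lebesgue. \<rho>0 y)"
    by (intro set_integral_Un set_integrable) auto
  ultimately have "integral\<^sup>L lebesgue (\<lambda>y. indicator (- {p 0..p N}) y *\<^sub>R \<rho>0 y) = 0"
    by (simp add: set_lebesgue_integral_def)
  moreover have "integrable lebesgue (\<lambda>y. indicator (- {p 0..p N}) y *\<^sub>R \<rho>0 y)"
    using set_integrable[of "- {p 0..p N}"] by (simp add: set_integrable_def)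
  moreover have "AE y in lebesgue. 0 \<le> indicator (- {p 0..p N}) y *\<^sub>R \<rho>0 y"
    using range by eventually_elim (simp add: indicator_def)
  ultimately have "AE y in lebesgue. indicator (- {p 0..p N}) y *\<^sub>R \<rho>0 y = 0"
    using integral_nonneg_eq_0_iff_AE by blast
  then show ?thesis by eventually_elim (auto simp: indicator_def)
qed

text \<open>Each cell has mass exactly \<open>l\<close>, so the initial discrete densities are the
  cell averages of \<open>\<rho>0\<close>.\<close>

lemma initial_jump_variation_le:
  assumes p: "initial_positions \<rho>0 l N p"
  shows "ennreal (jump_variation N (gap_density l N p)) \<le> TV \<rho>0"
proof (rule jump_variation_averages_le_TV)
  fix i assume i: "i < N"
  then have *: "p i < p (Suc i)" "integral {p i..p (Suc i)} \<rho>0 = l"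
    using initial_positions_props[OF p, of N] by simp_all
  then show "p i < p (Suc i)" by simp
  have "gap_density l N p i * (p (Suc i) - p i) = l" using * i by (simp add: gap_density_def)
  then show "(\<rho>0 has_integral gap_density l N p i * (p (Suc i) - p i)) {p i..p (Suc i)}"
    using integrable_integral[OF integrable_on, of "p i" "p (Suc i)"] *(2) by simp
qed (use AE_zero_outside_positions[OF p] in simp_all)

end

end

section \<open>The particle scheme\<close>

text \<open>Every difference quotient is a lower bound for all Lipschitz constants, hence also for
  their infimum.\<close>

lemma lipschitz_on_Lip_const:
  fixes v :: "real \<Rightarrow> real"
  assumes "C-lipschitz_on X v"
  shows "(Lip_const X v)-lipschitz_on X v"
proof (rule lipschitz_onI)
  let ?S = "{C. C-lipschitz_on X v}"
  have ne: "?S \<noteq> {}" using assms by blast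
  show "0 \<le> Lip_const X v"
    unfolding Lip_const_def using ne by (rule cInf_greatest) (auto intro: lipschitz_on_nonneg)
  fix a b assume ab: "a \<in> X" "b \<in> X"
  show "dist (v a) (v b) \<le> Lip_const X v * dist a b"
  proof (cases "a = b")
    case False
    have "dist (v a) (v b) / dist a b \<le> Lip_const X v"
      unfolding Lip_const_def using ne
    proof (rule cInf_greatest)
      fix K assume "K \<in> ?S"
      then show "dist (v a) (v b) / dist a b \<le> K"
        using lipschitz_onD[of K X v a b] ab False by (simp add: pos_divide_le_eq)
    qed
    then show ?thesis using False by (simp add: pos_divide_le_eq)
  qed simp
qed

lemma decreasing_velocity_C1:
  fixes v v' :: "real \<Rightarrow> real"
  assumes "0 < R"
    and deriv: "\<And>r. r \<in> {0..R} \<Longrightarrow> (v has_real_derivative v' r) (at r within {0..R})"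
    and cont: "continuous_on {0..R} v'"
    and neg: "\<And>r. r \<in> {0..R} \<Longrightarrow> v' r < 0"
  shows "decreasing_velocity v R (Lip_const {0..R} v)"
proof
  show "0 < R" by fact
  have contv: "continuous_on {0..R} v"
    using deriv by (intro DERIV_continuous_on)
  show "v b < v a" if ab: "0 \<le> a" "a < b" "b \<le> R" for a b
  proof (rule DERIV_neg_imp_decreasing_open[OF ab(2)])
    fix x assume "a < x" "x < b"
    then have "DERIV v x :> v' x" "v' x < 0"
      using deriv[of x] neg[of x] ab at_within_Icc_at[of 0 x R] by auto
    then show "\<exists>y. DERIV v x :> y \<and> y < 0" by blast
  next
    show "continuous_on {a..b} v" by (rule continuous_on_subset[OF contv]) (use ab in auto)
  qed
  have "bounded (v' ` {0..R})"
    by (intro compact_imp_bounded compact_continuous_image cont) simp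
  then obtain B where B: "0 < B" "\<And>r. r \<in> {0..R} \<Longrightarrow> norm (v' r) \<le> B"
    by (auto simp: bounded_pos)
  have "B-lipschitz_on {0..R} v"
  proof (rule lipschitz_onI)
    fix a b assume "a \<in> {0..R}" "b \<in> {0..R}"
    then show "dist (v a) (v b) \<le> B * dist a b"
      using field_differentiable_bound[of "{0..R}" v v' B a b] deriv B(2) by (simp add: dist_norm)
  qed (use B in simp)
  then show "(Lip_const {0..R} v)-lipschitz_on {0..R} v" by (rule lipschitz_on_Lip_const)
qed

section \<open>From single steps to the whole scheme\<close>

lemma cell_density_eq: "cell_density l N x m = gap_density l N (x m)"
  by (simp add: cell_density_def gap_density_def fun_eq_iff)

lemma particle_scheme_iff:
  assumes "0 < R" "0 < l"
  shows "particle_scheme v R \<theta> \<tau> l M N \<rho>0 x \<longleftrightarrow>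
    initial_positions \<rho>0 l N (x 0) \<and> (\<forall>m\<le>M. admissible R l N (x m)) \<and>
    (\<forall>m<M. \<forall>i\<le>N. time_step v \<theta> \<tau> l N (x m) (x (Suc m)) i)"
proof -
  have adm: "(\<forall>i<N. p i < p (Suc i)) \<and> (\<forall>i\<le>N. gap_density l N p i \<in> {0..R}) \<longleftrightarrow> admissible R l N p" for p
    using assms gap_density_nonneg[of R l N p] gap_density_le[of R l N p]
    by (auto simp: admissible_def gap_density_def)
  show ?thesis
    by (simp only: particle_scheme_def cell_density_eq time_step_def adm[symmetric]
        all_conj_distrib imp_conjR conj_assoc)
qed

text \<open>The time intervals are half-open and disjoint, so a time before \<open>T\<close> selects
  exactly one level. The final time is defined separately and gives \<open>m = M\<close>.\<close>

lemma discrete_density_eq_step_function: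
  assumes "0 < T" "0 < M" "0 \<le> t" "t \<le> T" and \<tau>: "\<tau> = T / real M"
  obtains m where "m \<le> M" "real m * \<tau> \<le> t" "t < real (Suc m) * \<tau>"
    "\<And>y. discrete_density l T M N x y t = step_function N (x m) (gap_density l N (x m)) y"
proof (cases "t = T")
  case True
  have "t = real M * \<tau>" "0 < \<tau>" using True assms by simp_all
  then show ?thesis
    using True by (intro that[of M])
      (simp_all add: discrete_density_def step_function_def cell_density_eq del: sum_mult_indicator)
next
  case False
  have \<tau>0: "0 < \<tau>" using assms by simp
  define m where "m = nat \<lfloor>t / \<tau>\<rfloor>"
  have rm: "real m = of_int \<lfloor>t / \<tau>\<rfloor>" using assms \<tau>0 by (simp add: m_def)
  have m: "real m * \<tau> \<le> t" "t < real (Suc m) * \<tau>"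
    using \<tau>0 rm by (simp_all add: pos_le_divide_eq[symmetric] pos_divide_less_eq[symmetric] add.commute[of 1])
  have uniq: "k = m" if "real k * \<tau> \<le> t" "t < real (Suc k) * \<tau>" for k
  proof -
    have "real k * \<tau> < real (Suc m) * \<tau>" "real m * \<tau> < real (Suc k) * \<tau>" using m that by linarith+
    then have "real k < real (Suc m)" "real m < real (Suc k)" using \<tau>0 by (simp_all only: mult_less_cancel_right_pos)
    then show ?thesis by simp
  qed
  have "real m * \<tau> < real M * \<tau>" using m False assms by simp
  then have mM: "m < M" using \<tau>0 by simp
  have ind: "indicator {real k * (T / real M)..<real (Suc k) * (T / real M)} t = (if k = m then 1 else 0 :: real)" for k
  proof -
    have "t \<in> {real k * (T / real M)..<real (Suc k) * (T / real M)} \<longleftrightarrow> k = m"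
      unfolding \<tau>[symmetric] atLeastLessThan_iff using m uniq[of k] by blast
    then show ?thesis by (simp only: indicator_def of_bool_def)
  qed
  have "discrete_density l T M N x y t = step_function N (x m) (gap_density l N (x m)) y" for y
  proof -
    have "discrete_density l T M N x y t
        = (\<Sum>k<M. if k = m then step_function N (x m) (gap_density l N (x m)) y else 0)"
      unfolding discrete_density_def if_not_P[OF False] ind
      by (intro sum.cong refl) (simp add: step_function_def cell_density_eq del: sum_mult_indicator)
    then show ?thesis using mM by simp
  qed
  then show ?thesis using m mM by (intro that[of m]) simp_all
qed

locale scheme = particle_step + initial_density \<rho>0 R L for \<rho>0 :: "real \<Rightarrow> real" and L :: real +
  assumes N_pos: "0 < N" and l_def: "l = L / real N"
begin

abbreviation "V \<equiv> max \<bar>v 0\<bar> \<bar>v R\<bar>"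

lemma scheme_exists: "\<exists>x. particle_scheme v R \<theta> \<tau> l M N \<rho>0 x"
proof -
  obtain p where p: "initial_positions \<rho>0 l N p"
    using initial_positions_exist[OF l_def N_pos] by blast
  \<comment> \<open>Levels are chosen for all \<open>m\<close>, also beyond \<open>M\<close>;
    admissibility is the invariant that allows the next step, and the clause for
    \<open>m = 0\<close> pins the start.\<close>
  have "\<exists>x. \<forall>m. (admissible R l N (x m) \<and> (m = 0 \<longrightarrow> x m = p))
      \<and> (\<forall>i\<le>N. time_step v \<theta> \<tau> l N (x m) (x (Suc m)) i)"
  proof (rule dependent_nat_choice)
    show "\<exists>q. admissible R l N q \<and> (0 = 0 \<longrightarrow> q = p)"
      using initial_positions_admissible[OF l_def N_pos p] by blast
    show "\<exists>q. (admissible R l N q \<and> (Suc m = 0 \<longrightarrow> q = p)) \<and> (\<forall>i\<le>N. time_step v \<theta> \<tau> l N y q i)"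
      if y: "admissible R l N y \<and> (m = 0 \<longrightarrow> y = p)" for y m
      using time_step_exists[OF conjunct1[OF y]] by simp
  qed
  then obtain x where "\<And>m. admissible R l N (x m)" "x 0 = p"
      "\<And>m i. i \<le> N \<Longrightarrow> time_step v \<theta> \<tau> l N (x m) (x (Suc m)) i"
    by blast
  then show ?thesis using p by (intro exI[of _ x]) (simp add: particle_scheme_iff[OF R_pos l])
qed

lemma scheme_unique:
  assumes "particle_scheme v R \<theta> \<tau> l M N \<rho>0 x" "particle_scheme v R \<theta> \<tau> l M N \<rho>0 z"
  shows "m \<le> M \<Longrightarrow> i \<le> N \<Longrightarrow> x m i = z m i"
proof (induction m arbitrary: i)
  case 0
  have "initial_positions \<rho>0 l N (x 0)" "initial_positions \<rho>0 l N (z 0)"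
    using assms by (simp_all add: particle_scheme_iff[OF R_pos l])
  then show ?case using 0(2) by (rule initial_positions_unique[OF l_def N_pos])
next
  case (Suc m)
  show ?case
  proof (rule time_step_unique[of "x m" "z m"])
    show "x m j = z m j" if "j \<le> N" for j using Suc.IH[of j] Suc.prems that by simp
    show "i \<le> N" by fact
  qed (use assms Suc.prems in \<open>simp_all add: particle_scheme_iff[OF R_pos l]\<close>)
qed

context
  fixes M :: nat and x :: "nat \<Rightarrow> nat \<Rightarrow> real"
  assumes x: "particle_scheme v R \<theta> \<tau> l M N \<rho>0 x"
begin

abbreviation "level m \<equiv> step_function N (x m) (gap_density l N (x m))"

abbreviation "level_variation m \<equiv> jump_variation N (gap_density l N (x m))"

lemma initial: "initial_positions \<rho>0 l N (x 0)"
  and adm: "m \<le> M \<Longrightarrow> admissible R l N (x m)"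
  and evolve: "m < M \<Longrightarrow> i \<le> N \<Longrightarrow> time_step v \<theta> \<tau> l N (x m) (x (Suc m)) i"
  using x unfolding particle_scheme_iff[OF R_pos l] by auto

lemma level_range: "m \<le> M \<Longrightarrow> 0 \<le> level m y \<and> level m y \<le> R"
  using step_function_cases[of N "x m" "gap_density l N (x m)" y] admissible_less[OF adm, of m]
    gap_density_nonneg[OF adm l, of m] gap_density_le[OF adm R_pos, of m] R_pos by auto

lemma TV_level: "m \<le> M \<Longrightarrow> TV (level m) = ennreal (level_variation m)"
  using admissible_less[OF adm, of m] by (intro TV_step_function) simp_all

lemma level_variation_Suc: "m < M \<Longrightarrow> level_variation (Suc m) \<le> level_variation m"
  using adm evolve by (intro time_step_jump_variation) simp_all

lemma level_variation_le: "m \<le> M \<Longrightarrow> ennreal (level_variation m) \<le> TV \<rho>0"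
proof (induction m)
  case 0
  then show ?case using initial_jump_variation_le[OF l_def N_pos initial] by simp
next
  case (Suc m)
  then show ?case
    using level_variation_Suc[of m] by (meson Suc_leD Suc_le_lessD ennreal_leI order_trans)
qed

text \<open>The entry jump at the first cell is positive. This makes \<open>TV \<rho>0\<close>
  positive, as the choice of the averaging window requires.\<close>

lemma level_variation_pos: "0 < level_variation 0"
proof -
  have "0 < gap_density l N (x 0) 0" by (rule gap_density_pos[OF adm l N_pos]) simp
  then have "0 < \<bar>jump (gap_density l N (x 0)) 0\<bar>" by simp
  also have "\<dots> \<le> level_variation 0"
    unfolding jump_variation_def by (rule member_le_sum) auto
  finally show ?thesis .
qed

lemma displacement: "m \<le> m' \<Longrightarrow> m' \<le> M \<Longrightarrow> i \<le> N \<Longrightarrow> \<bar>x m' i - x m i\<bar> \<le> real (m' - m) * (\<tau> * V)"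
proof (induction m' rule: dec_induct)
  case (step k)
  have "\<bar>x (Suc k) i - x k i\<bar> \<le> \<tau> * V"
    using adm evolve step by (intro time_step_displacement) auto
  moreover have "\<bar>x k i - x m i\<bar> \<le> real (k - m) * (\<tau> * V)" using step by simp
  moreover have "real (Suc k - m) * (\<tau> * V) = real (k - m) * (\<tau> * V) + \<tau> * V"
    using step by (simp add: Suc_diff_le algebra_simps)
  ultimately show ?case by linarith
qed simp

text \<open>\<open>s\<close> may be any positive bound for the elapsed grid time, because rounding
  can make that time longer than the true one. Its positivity keeps the displacement bound
  \<open>s * V\<close> positive even for \<open>m = m'\<close>.\<close>

lemma L1_levels_le:
  assumes fin: "TV \<rho>0 < \<infinity>" and m: "m \<le> m'" "m' \<le> M" and s: "real (m' - m) * \<tau> \<le> s" "0 < s"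
  shows "L1_norm (\<lambda>y. level m' y - level m y)
    \<le> ennreal (4 * sqrt (2 * enn2real (TV \<rho>0) * L * V) * sqrt s)"
proof -
  let ?B = "enn2real (TV \<rho>0)"
  have B: "level_variation k \<le> ?B" if "k \<le> M" for k
    using level_variation_le[OF that] fin jump_variation_nonneg[of N "gap_density l N (x k)"]
    by (cases "TV \<rho>0") (auto simp: ennreal_le_iff)
  have V: "0 < V" by (rule v_bound_pos)
  have "L1_norm (\<lambda>y. level m' y - level m y) \<le> ennreal (4 * sqrt (2 * ?B * (real N * l) * (s * V)))"
  proof (rule L1_step_function_diff_le)
    show "\<bar>x m' i - x m i\<bar> \<le> s * V" if "i \<le> N" for i
    proof -
      have "real (m' - m) * \<tau> * V \<le> s * V" using s(1) V by (intro mult_right_mono) auto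
      then show ?thesis using displacement[OF m that] by simp
    qed
    show "0 < ?B" using B[of 0] level_variation_pos by simp
    show "0 < s * V" using s V by simp
  qed (use admissible_less[OF adm] m l N_pos B in auto)
  also have "2 * ?B * (real N * l) * (s * V) = (2 * ?B * L * V) * s"
    using l_def N_pos by simp
  finally show ?thesis by (simp only: real_sqrt_mult mult.assoc)
qed

end

end

theorem theorem2p2:
  fixes R T \<theta> L \<tau> l V C :: real
    and v v' \<rho>0 :: "real \<Rightarrow> real"
    and M N :: nat
  assumes "R > 0"
    and "\<And>r. r \<in> {0..R} \<Longrightarrow> (v has_real_derivative v' r) (at r within {0..R})"
    and "continuous_on {0..R} v'"
    and "\<And>r. r \<in> {0..R} \<Longrightarrow> v' r < 0"
    and "Linf_compact \<rho>0" and "BV \<rho>0"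
    and "AE y in lebesgue. 0 \<le> \<rho>0 y \<and> \<rho>0 y \<le> R"
    and "L1_norm \<rho>0 = ennreal L" and "L > 0"
    and "T > 0" and "\<theta> \<in> {0..1}" and "M > 0" and "N > 0"
    and "\<theta> * real N * T * Lip_const {0..R} v * R^2 < L * real M"
    and "\<tau> = T / real M" and "l = L / real N"
    and "V = max \<bar>v 0\<bar> \<bar>v R\<bar>"
    and "C = 4 * sqrt (2 * enn2real (TV \<rho>0) * L * V)"
  shows "(\<exists>x. particle_scheme v R \<theta> \<tau> l M N \<rho>0 x) \<and>
    (\<forall>x z. particle_scheme v R \<theta> \<tau> l M N \<rho>0 x \<and> particle_scheme v R \<theta> \<tau> l M N \<rho>0 z
        \<longrightarrow> (\<forall>m\<le>M. \<forall>i\<le>N. x m i = z m i)) \<and>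
    (\<forall>x. particle_scheme v R \<theta> \<tau> l M N \<rho>0 x \<longrightarrow>
      (let \<rho> = discrete_density l T M N x in
        (\<forall>y. \<forall>t\<in>{0..T}. 0 \<le> \<rho> y t \<and> \<rho> y t \<le> R) \<and>
        (\<forall>m<M. TV (\<lambda>y. \<rho> y (real (Suc m) * \<tau>)) \<le> TV (\<lambda>y. \<rho> y (real m * \<tau>))
              \<and> TV (\<lambda>y. \<rho> y (real m * \<tau>)) \<le> TV \<rho>0) \<and>
        (\<forall>t1 t2. 0 \<le> t1 \<and> t1 \<le> t2 \<and> t2 \<le> T \<longrightarrow>
          L1_norm (\<lambda>y. \<rho> y t2 - \<rho> y t1) \<le> ennreal (C * sqrt (t2 - t1 + \<tau>)))))"
proof -
  let ?K = "Lip_const {0..R} v"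
  have \<tau>: "0 < \<tau>" using assms by simp
  \<comment> \<open>The assumed CFL condition with the denominators of \<open>\<tau>\<close> and
    \<open>l\<close> cleared.\<close>
  have "\<theta> * \<tau> * ?K * R\<^sup>2 * (real N * real M) < l * (real N * real M)"
    using assms(14) assms(12,13) unfolding assms(15,16) by (simp add: ac_simps)
  then have CFL: "\<theta> * \<tau> * ?K * R\<^sup>2 < l"
    using assms(12,13) by (subst (asm) mult_less_cancel_right_pos) auto
  interpret decreasing_velocity v R ?K
    by (rule decreasing_velocity_C1) fact+
  interpret scheme v R ?K \<theta> \<tau> l N \<rho>0 L
    by unfold_locales (use assms \<tau> CFL in \<open>auto simp: BV_def Linf_compact_def\<close>)
  have fin: "TV \<rho>0 < \<infinity>" using assms(6) by (simp add: BV_def)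
  have density: "\<exists>m\<le>M. real m * \<tau> \<le> t \<and> t < real (Suc m) * \<tau> \<and>
      (\<forall>y. discrete_density l T M N x y t = step_function N (x m) (gap_density l N (x m)) y)"
    if "0 \<le> t" "t \<le> T" for t x
    using discrete_density_eq_step_function[OF assms(10,12) that assms(15), of l N x] by metis
  have at_level: "discrete_density l T M N x y (real m * \<tau>) = step_function N (x m) (gap_density l N (x m)) y"
    if m: "m \<le> M" for x y m
  proof -
    have "real m * \<tau> \<le> real M * \<tau>" using m \<tau> by (intro mult_right_mono) auto
    then have "real m * \<tau> \<le> T" using assms(12,15) by simp
    then obtain k where k: "real k * \<tau> \<le> real m * \<tau>" "real m * \<tau> < real (Suc k) * \<tau>"
        "discrete_density l T M N x y (real m * \<tau>) = step_function N (x k) (gap_density l N (x k)) y"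
      using density[of "real m * \<tau>" x] \<tau> by auto
    then have "real k \<le> real m" "real m < real (Suc k)"
      using \<tau> by (simp_all only: mult_less_cancel_right_pos mult_le_cancel_right_pos)
    then have "k = m" by simp
    then show ?thesis using k(3) by simp
  qed
  have part3: "(let \<rho> = discrete_density l T M N x in
        (\<forall>y. \<forall>t\<in>{0..T}. 0 \<le> \<rho> y t \<and> \<rho> y t \<le> R) \<and>
        (\<forall>m<M. TV (\<lambda>y. \<rho> y (real (Suc m) * \<tau>)) \<le> TV (\<lambda>y. \<rho> y (real m * \<tau>))
              \<and> TV (\<lambda>y. \<rho> y (real m * \<tau>)) \<le> TV \<rho>0) \<and>
        (\<forall>t1 t2. 0 \<le> t1 \<and> t1 \<le> t2 \<and> t2 \<le> T \<longrightarrow>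
          L1_norm (\<lambda>y. \<rho> y t2 - \<rho> y t1) \<le> ennreal (C * sqrt (t2 - t1 + \<tau>))))"
    if x: "particle_scheme v R \<theta> \<tau> l M N \<rho>0 x" for x
    unfolding Let_def
  proof (intro conjI allI impI ballI)
    fix y t assume "t \<in> {0..T}"
    then obtain m where "m \<le> M"
      "discrete_density l T M N x y t = step_function N (x m) (gap_density l N (x m)) y"
      using density[of t x] by auto
    then show "0 \<le> discrete_density l T M N x y t" "discrete_density l T M N x y t \<le> R"
      using level_range[OF x, of m y] by auto
  next
    fix m assume m: "m < M"
    have TV: "TV (\<lambda>y. discrete_density l T M N x y (real k * \<tau>))
        = ennreal (jump_variation N (gap_density l N (x k)))" if "k \<le> M" for k
      using TV_level[OF x that] by (simp only: at_level[OF that])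
    show "TV (\<lambda>y. discrete_density l T M N x y (real (Suc m) * \<tau>))
        \<le> TV (\<lambda>y. discrete_density l T M N x y (real m * \<tau>))"
      using TV[of m] TV[of "Suc m"] m level_variation_Suc[OF x m] by (simp only: ennreal_leI less_imp_le Suc_leI)
    show "TV (\<lambda>y. discrete_density l T M N x y (real m * \<tau>)) \<le> TV \<rho>0"
      using TV[of m] m level_variation_le[OF x, of m] by simp
  next
    fix t1 t2 assume t: "0 \<le> t1 \<and> t1 \<le> t2 \<and> t2 \<le> T"
    obtain m1 where m1: "m1 \<le> M" "real m1 * \<tau> \<le> t1" "t1 < real (Suc m1) * \<tau>"
        "\<And>y. discrete_density l T M N x y t1 = step_function N (x m1) (gap_density l N (x m1)) y"
      using density[of t1 x] t by auto
    obtain m2 where m2: "m2 \<le> M" "real m2 * \<tau> \<le> t2" "t2 < real (Suc m2) * \<tau>"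
        "\<And>y. discrete_density l T M N x y t2 = step_function N (x m2) (gap_density l N (x m2)) y"
      using density[of t2 x] t by auto
    have "real m1 * \<tau> < real (Suc m2) * \<tau>" using m1 m2 t by linarith
    then have "real m1 < real (Suc m2)" using \<tau> by (simp only: mult_less_cancel_right_pos)
    then have m12: "m1 \<le> m2" by simp
    \<comment> \<open>From \<open>real m2 * \<tau> \<le> t2\<close> and
      \<open>t1 < real (Suc m1) * \<tau>\<close>; the successor is the source of the extra
      \<open>\<tau>\<close> under the root.\<close>
    have "real (m2 - m1) * \<tau> \<le> t2 - t1 + \<tau>"
      using m1 m2 m12 by (simp add: of_nat_diff algebra_simps)
    then show "L1_norm (\<lambda>y. discrete_density l T M N x y t2 - discrete_density l T M N x y t1)
        \<le> ennreal (C * sqrt (t2 - t1 + \<tau>))"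
      unfolding m1(4) m2(4) assms(17,18)
      using t \<tau> by (intro L1_levels_le[OF x fin m12 m2(1)]) auto
  qed
  show ?thesis using scheme_exists scheme_unique part3 by blast
qed

end
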